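(* Let $\omega_r:[0,\infty)\to\mathfrak{so}(3)$ be a given target velocity (Lebesgue measurable and essentially bounded on bounded time intervals; it is not assumed to be bounded on $[0,\infty)$). Consider the system on $SO(3)\times SO(3)$ $$\dot R_r=R_r\,\omega_r,\qquad \dot R_1=R_1\,\omega_1,$$ where $\omega_1\in\mathfrak{so}(3)$ is a control input, and the two feedback laws $$\omega_{1,a}=R_1^\top R_r-R_r^\top R_1+\omega_r,\qquad \omega_{1,f}=\frac{1}{\|R_1-R_r\|_F}\big(R_1^\top R_r-R_r^\top R_1\big)+\omega_r .$$ Assume that the initial condition is non-singular, i.e. $\arccos\!\Big(\frac{\operatorname{tr}(R_r^\top(0)R_1(0))-1}{2}\Big)\neq\pi$. Then: (1) Both for $\omega_1=\omega_{1,a}$ and for $\omega_1=\omega_{1,f}$ the singularity is avoided for all time: every maximal solution of the closed loop with such an initial condition is defined for all $t\ge 0$ and satisfies $\arccos\!\Big(\frac{\operatorname{tr}(R_r^\top(t)R_1(t))-1}{2}\Big)\neq\pi$ for all $t\geq 0$. (2) With $\omega_1=\omega_{1,a}$, $R_1$ tracks $R_r$ exponentially. With $\omega_1=\omega_{1,f}$, $R_1$ tracks $R_r$ in finite time, and this holds for every Filippov solution of the closed loop with such an initial condition.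
   Context: $SO(3)=\{R\in\mathbb{R}^{3\times3}: RR^\top=I,\ \det R=1\}$; $\mathfrak{so}(3)$ is the space of real skew-symmetric $3\times3$ matrices; $\|\cdot\|_F$ is the Frobenius norm. Solutions. For $\omega_{1,a}$, solutions are absolutely continuous curves satisfying the closed-loop equations for almost all $t$. For $\omega_{1,f}$, whose formula is undefined and discontinuous at $R_1=R_r$, solutions are Filippov solutions: absolutely continuous curves $(R_r(t),R_1(t))$ satisfying, for almost all $t$, $$\dot R_r=R_r\omega_r(t),\qquad \dot R_1\in\mathcal F[R_1\omega_{1,f}](R_r(t),R_1(t),t).$$ Here, for a vector field $f(x,t)$, $$\mathcal F[f](x,t)=\bigcap_{\delta>0}\ \bigcap_{\mu(S)=0}\overline{\mathrm{co}}\{f(B(x,\delta)\setminus S,\,t)\},$$ where $B(x,\delta)$ is the ball of radius $\delta$ around $x$ in the state space $SO(3)\times SO(3)$, $S$ ranges over the null sets of the state space, $\mu$ is the Lebesgue (Riemannian volume) measure on it, and $\overline{\mathrm{co}}$ is the closed convex hull. A solution is maximal if it cannot be extended forward in time. Tracking. $R_1$ tracks $R_r$ exponentially if there are constants $C,c>0$ (possibly depending on the solution) with $\|R_1(t)-R_r(t)\|_F\leq Ce^{-ct}$ for all $t\geq0$. $R_1$ tracks $R_r$ in finite time if there exists $T>0$ such that $R_1(t)-R_r(t)\to0$ as $t\to T$. *)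

theory Defs
  imports "HOL-Analysis.Analysis"
begin

section \<open>The state space\<close>

type_synonym mat3 = "real^3^3"

definition SO3 :: "mat3 set" where
  "SO3 = {R. R ** transpose R = mat 1 \<and> det R = 1}"

definition so3 :: "mat3 set" where
  "so3 = {A. transpose A = - A}"

definition state_space :: "(mat3 \<times> mat3) set" where
  "state_space = SO3 \<times> SO3"

text \<open>The library norm on matrices is the Frobenius norm, so \<open>norm\<close> is used for it throughout.\<close>

lemma norm_eq_frobenius: "norm (A :: mat3) = sqrt (\<Sum>i\<in>UNIV. \<Sum>j\<in>UNIV. (A $ i $ j)\<^sup>2)"
  by (simp add: norm_vec_def L2_set_def sum_nonneg)

definition rotation_distance :: "mat3 \<Rightarrow> mat3 \<Rightarrow> real" where
  "rotation_distance Rr R1 = arccos ((trace (transpose Rr ** R1) - 1) / 2)"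


section \<open>Null sets of the state space\<close>

text \<open>
  The state space is a submanifold of dimension 6.  In local coordinates its Riemannian volume is
  Lebesgue measure on an open subset of the coordinate space \<open>\<real>\<^sup>3 \<times> \<real>\<^sup>3\<close>, multiplied by the
  continuous positive density \<open>sqrt (det g)\<close>.  A set is therefore null iff it is Lebesgue null in
  all local coordinates; \<open>negligible\<close> is the library's notion of a Lebesgue null set.
\<close>

definition local_parametrization ::
  "((real^3) \<times> (real^3)) set \<Rightarrow> ((real^3) \<times> (real^3) \<Rightarrow> mat3 \<times> mat3) \<Rightarrow> bool" where
  "local_parametrization U \<phi> \<longleftrightarrow>
     open U \<and> \<phi> ` U \<subseteq> state_space \<and> inj_on \<phi> U \<and>
     (\<exists>\<phi>'. (\<forall>u\<in>U. (\<phi> has_derivative \<phi>' u) (at u) \<and> inj (\<phi>' u)) \<and>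
           (\<forall>v. continuous_on U (\<lambda>u. \<phi>' u v)))"

definition null_in_state_space :: "(mat3 \<times> mat3) set \<Rightarrow> bool" where
  "null_in_state_space S \<longleftrightarrow>
     S \<subseteq> state_space \<and>
     (\<forall>U \<phi>. local_parametrization U \<phi> \<longrightarrow> negligible {u \<in> U. \<phi> u \<in> S})"


section \<open>The Filippov set-valued map\<close>

text \<open>
  Balls are taken in the metric inherited from the ambient Euclidean space; it induces the same
  topology on the state space as the Riemannian distance, hence gives the same intersection.
\<close>

definition filippov ::
  "(mat3 \<times> mat3 \<Rightarrow> real \<Rightarrow> mat3) \<Rightarrow> mat3 \<times> mat3 \<Rightarrow> real \<Rightarrow> mat3 set" where
  "filippov f x t =
     (\<Inter>\<delta>\<in>{0<..}. \<Inter>S\<in>Collect null_in_state_space.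
        closure (convex hull ((\<lambda>y. f y t) ` (ball x \<delta> \<inter> state_space - S))))"


section \<open>Absolutely continuous curves\<close>

definition absolutely_continuous_on_Icc ::
  "real \<Rightarrow> real \<Rightarrow> (real \<Rightarrow> 'a::real_normed_vector) \<Rightarrow> bool" where
  "absolutely_continuous_on_Icc a b f \<longleftrightarrow>
     (\<forall>\<epsilon>>0. \<exists>\<delta>>0. \<forall>(n::nat) s t.
        (\<forall>i<n. a \<le> s i \<and> s i \<le> t i \<and> t i \<le> b) \<and>
        disjoint_family_on (\<lambda>i. {s i<..<t i}) {..<n} \<and>
        (\<Sum>i<n. t i - s i) < \<delta> \<longrightarrow>
        (\<Sum>i<n. norm (f (t i) - f (s i))) < \<epsilon>)"

text \<open>On an interval that need not be compact, absolute continuity is required on each compact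
  subinterval.\<close>

definition absolutely_continuous_curve ::
  "real set \<Rightarrow> (real \<Rightarrow> 'a::real_normed_vector) \<Rightarrow> bool" where
  "absolutely_continuous_curve J f \<longleftrightarrow>
     (\<forall>a b. a \<le> b \<and> {a..b} \<subseteq> J \<longrightarrow> absolutely_continuous_on_Icc a b f)"


section \<open>Target velocities, feedback laws and solutions\<close>

definition target_velocity :: "(real \<Rightarrow> mat3) \<Rightarrow> bool" where
  "target_velocity \<omega>r \<longleftrightarrow>
     (\<forall>t\<ge>0. \<omega>r t \<in> so3) \<and>
     \<omega>r \<in> borel_measurable (lebesgue_on {0..}) \<and>
     (\<forall>T\<ge>0. \<exists>B. AE t in lebesgue_on {0..T}. norm (\<omega>r t) \<le> B)"

definition omega_a :: "mat3 \<Rightarrow> mat3 \<Rightarrow> mat3 \<Rightarrow> mat3" where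
  "omega_a Rr R1 w = transpose R1 ** Rr - transpose Rr ** R1 + w"

text \<open>At \<open>R1 = Rr\<close> the convention \<open>1 / 0 = 0\<close> assigns a value to the formula below.  This value is
  immaterial, since \<open>omega_f\<close> is used only inside \<open>filippov\<close> and the diagonal is a null set.\<close>

definition omega_f :: "mat3 \<Rightarrow> mat3 \<Rightarrow> mat3 \<Rightarrow> mat3" where
  "omega_f Rr R1 w =
     (1 / norm (R1 - Rr)) *\<^sub>R (transpose R1 ** Rr - transpose Rr ** R1) + w"

text \<open>Domains of solutions are intervals with left endpoint 0 that belongs to them.  The one-point
  interval is included, so that maximality of a solution never holds merely because no solution
  starts at its initial state.\<close>

definition solution_domain :: "real set \<Rightarrow> bool" where
  "solution_domain J \<longleftrightarrow> is_interval J \<and> 0 \<in> J \<and> J \<subseteq> {0..}"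

definition state_curve :: "real set \<Rightarrow> (real \<Rightarrow> mat3) \<Rightarrow> (real \<Rightarrow> mat3) \<Rightarrow> bool" where
  "state_curve J Rr R1 \<longleftrightarrow>
     solution_domain J \<and>
     (\<forall>t\<in>J. (Rr t, R1 t) \<in> state_space) \<and>
     absolutely_continuous_curve J Rr \<and> absolutely_continuous_curve J R1"

definition solution_a ::
  "(real \<Rightarrow> mat3) \<Rightarrow> real set \<Rightarrow> (real \<Rightarrow> mat3) \<Rightarrow> (real \<Rightarrow> mat3) \<Rightarrow> bool" where
  "solution_a \<omega>r J Rr R1 \<longleftrightarrow>
     state_curve J Rr R1 \<and>
     (AE t in lebesgue_on J.
        (Rr has_vector_derivative Rr t ** \<omega>r t) (at t within J) \<and>
        (R1 has_vector_derivative R1 t ** omega_a (Rr t) (R1 t) (\<omega>r t)) (at t within J))"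

definition solution_f ::
  "(real \<Rightarrow> mat3) \<Rightarrow> real set \<Rightarrow> (real \<Rightarrow> mat3) \<Rightarrow> (real \<Rightarrow> mat3) \<Rightarrow> bool" where
  "solution_f \<omega>r J Rr R1 \<longleftrightarrow>
     state_curve J Rr R1 \<and>
     (AE t in lebesgue_on J.
        (Rr has_vector_derivative Rr t ** \<omega>r t) (at t within J) \<and>
        (\<exists>V \<in> filippov (\<lambda>(Pr, P1) t. P1 ** omega_f Pr P1 (\<omega>r t)) (Rr t, R1 t) t.
           (R1 has_vector_derivative V) (at t within J)))"

definition maximal_solution ::
  "(real set \<Rightarrow> (real \<Rightarrow> mat3) \<Rightarrow> (real \<Rightarrow> mat3) \<Rightarrow> bool) \<Rightarrow>
   real set \<Rightarrow> (real \<Rightarrow> mat3) \<Rightarrow> (real \<Rightarrow> mat3) \<Rightarrow> bool" where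
  "maximal_solution sol J Rr R1 \<longleftrightarrow>
     sol J Rr R1 \<and>
     \<not> (\<exists>K Sr S1. sol K Sr S1 \<and> J \<subset> K \<and> (\<forall>t\<in>J. Sr t = Rr t \<and> S1 t = R1 t))"


section \<open>Tracking\<close>

definition tracks_exponentially :: "(real \<Rightarrow> mat3) \<Rightarrow> (real \<Rightarrow> mat3) \<Rightarrow> bool" where
  "tracks_exponentially R1 Rr \<longleftrightarrow>
     (\<exists>C>0. \<exists>c>0. \<forall>t\<ge>0. norm (R1 t - Rr t) \<le> C * exp (- c * t))"

definition tracks_in_finite_time :: "(real \<Rightarrow> mat3) \<Rightarrow> (real \<Rightarrow> mat3) \<Rightarrow> bool" where
  "tracks_in_finite_time R1 Rr \<longleftrightarrow>
     (\<exists>T>0. ((\<lambda>t. R1 t - Rr t) \<longlongrightarrow> 0) (at T))"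

end

theory Submission
  imports Defs
begin

text \<open>
  The relative rotation \<open>Q = R1 Rr\<^sup>T\<close> does not see the target velocity: it satisfies \<open>Q' = I - Q\<^sup>2\<close>
  for the first law and \<open>Q' = (I - Q\<^sup>2) / norm (Q - I)\<close> for the second one.  Nonsingular rotations
  are exactly the Cayley transforms \<open>cayley p\<close>, and both equations preserve the rays
  \<open>s \<mapsto> cayley (s p)\<close>, on which they reduce to scalar equations with explicit solutions:
  \<open>s = exp (-2t)\<close> for the first law, while for the second one \<open>s\<close> vanishes after a finite time.
  Together with a solution of the linear equation for \<open>Rr\<close> this gives a global solution of the closed
  loop.  Solutions are unique forward in time because both fields are one-sided Lipschitz in \<open>R1\<close>, a
  property that passes to the Filippov map, since it says that the values of the field lie in closed
  half-spaces depending continuously on the state.  Hence every maximal solution is the explicit one.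
\<close>

section \<open>Absolutely continuous functions\<close>

text \<open>In the coordinate \<open>p\<close> the singular set lies at infinity:
  \<open>norm p\<close> is the tangent of half the rotation angle. A curve on a ray avoids it by
  construction. The delicate point is that a Filippov velocity on the diagonal is known only through
  closed convex hulls. In terms of the error E = R1 - Rr the feedback is -2 E - E Rr^T E, divided by
  \<open>norm E\<close> for the second law. The discontinuous part -2 E / norm E is minus twice a
  subgradient of the convex norm, so its jump has the contracting sign; the remainder is tame. This
  is why an estimate from one side succeeds where a Lipschitz bound fails, and why uniqueness is
  claimed forward in time. The explicit curve has two duties: solutions are compared with it, and it
  extends any solution that stops early. For the second duty it must itself be a Filippov solution
  after reaching the diagonal, so a velocity has to be exhibited there, as a limit of convex
  combinations. Since derivatives exist only almost everywhere, each comparison rests on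
  monotonicity of absolutely continuous functions.\<close>

lemma absolutely_continuous_on_Icc_finite_family:
  assumes "absolutely_continuous_on_Icc a b f" "0 < \<epsilon>"
  shows "\<exists>\<delta>>0. \<forall>(I :: 'i set) l r. finite I \<longrightarrow> (\<forall>i\<in>I. a \<le> l i \<and> l i \<le> r i \<and> r i \<le> b) \<longrightarrow>
      disjoint_family_on (\<lambda>i. {l i<..<r i}) I \<longrightarrow> (\<Sum>i\<in>I. r i - l i) < \<delta> \<longrightarrow>
      (\<Sum>i\<in>I. norm (f (r i) - f (l i))) < \<epsilon>"
proof -
  obtain \<delta> where "\<delta> > 0" and \<delta>: "\<forall>(n::nat) s t.
        (\<forall>i<n. a \<le> s i \<and> s i \<le> t i \<and> t i \<le> b) \<and>
        disjoint_family_on (\<lambda>i. {s i<..<t i}) {..<n} \<and>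
        (\<Sum>i<n. t i - s i) < \<delta> \<longrightarrow>
        (\<Sum>i<n. norm (f (t i) - f (s i))) < \<epsilon>"
    using assms unfolding absolutely_continuous_on_Icc_def by blast
  show ?thesis
  proof (rule exI[of _ \<delta>], intro conjI allI impI \<open>\<delta> > 0\<close>)
    fix I :: "'i set" and l r :: "'i \<Rightarrow> real"
    assume I: "finite I" and lr: "\<forall>i\<in>I. a \<le> l i \<and> l i \<le> r i \<and> r i \<le> b"
      and dis: "disjoint_family_on (\<lambda>i. {l i<..<r i}) I" and less: "(\<Sum>i\<in>I. r i - l i) < \<delta>"
    obtain h where h: "bij_betw h {..<card I} I"
      using ex_bij_betw_nat_finite[OF I] by (auto simp: atLeast0LessThan)
    have hI: "h i \<in> I" if "i < card I" for i
      using h that by (auto simp: bij_betw_def)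
    have "(\<Sum>i<card I. norm (f (r (h i)) - f (l (h i)))) < \<epsilon>"
    proof (rule \<delta>[rule_format], intro conjI)
      show "\<forall>i<card I. a \<le> l (h i) \<and> l (h i) \<le> r (h i) \<and> r (h i) \<le> b"
        using lr hI by blast
      show "disjoint_family_on (\<lambda>i. {l (h i)<..<r (h i)}) {..<card I}"
        unfolding disjoint_family_on_def
      proof (intro ballI impI)
        fix m n assume "m \<in> {..<card I}" "n \<in> {..<card I}" "m \<noteq> n"
        then have "h m \<noteq> h n" "h m \<in> I" "h n \<in> I"
          using h hI by (auto simp: bij_betw_def inj_on_def)
        then show "{l (h m)<..<r (h m)} \<inter> {l (h n)<..<r (h n)} = {}"
          using dis unfolding disjoint_family_on_def by blast
      qed
      show "(\<Sum>i<card I. r (h i) - l (h i)) < \<delta>"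
        using less sum.reindex_bij_betw[OF h, of "\<lambda>i. r i - l i"] by simp
    qed
    then show "(\<Sum>i\<in>I. norm (f (r i) - f (l i))) < \<epsilon>"
      using sum.reindex_bij_betw[OF h, of "\<lambda>i. norm (f (r i) - f (l i))"] by simp
  qed
qed

lemma absolutely_continuous_on_Icc_imp_continuous_on:
  assumes "absolutely_continuous_on_Icc a b f"
  shows "continuous_on {a..b} f"
  unfolding continuous_on_iff
proof (intro ballI allI impI)
  fix x and e :: real assume x: "x \<in> {a..b}" "0 < e"
  obtain d where "d > 0" and d: "\<forall>(I :: (unit) set) l r. finite I \<longrightarrow> (\<forall>i\<in>I. a \<le> l i \<and> l i \<le> r i \<and> r i \<le> b) \<longrightarrow>
      disjoint_family_on (\<lambda>i. {l i<..<r i}) I \<longrightarrow> (\<Sum>i\<in>I. r i - l i) < d \<longrightarrow>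
      (\<Sum>i\<in>I. norm (f (r i) - f (l i))) < e"
    using absolutely_continuous_on_Icc_finite_family[OF assms \<open>0 < e\<close>, where ?'i = "unit"] by blast
  have "dist (f y) (f x) < e" if "y \<in> {a..b}" "dist y x < d" for y
  proof -
    have "(\<Sum>i\<in>{()}. norm (f (max x y) - f (min x y))) < e"
      by (rule d[rule_format]) (use x that in \<open>auto simp: disjoint_family_on_def dist_real_def\<close>)
    then show ?thesis
      by (auto simp: max_def min_def dist_norm norm_minus_commute split: if_splits)
  qed
  then show "\<exists>d>0. \<forall>x'\<in>{a..b}. dist x' x < d \<longrightarrow> dist (f x') (f x) < e"
    using \<open>d > 0\<close> by blast
qed

lemma sum_length_le_measure:
  fixes l r :: "'i \<Rightarrow> real"
  assumes "finite I" "disjoint_family_on (\<lambda>i. {l i<..<r i}) I" "\<And>i. i \<in> I \<Longrightarrow> l i \<le> r i"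
    and "\<And>i. i \<in> I \<Longrightarrow> {l i<..<r i} \<subseteq> U" "U \<in> lmeasurable"
  shows "(\<Sum>i\<in>I. r i - l i) \<le> measure lebesgue U"
proof -
  have "(\<Sum>i\<in>I. r i - l i) = (\<Sum>i\<in>I. measure lebesgue {l i<..<r i})"
    using assms(3) by (intro sum.cong) (auto simp: measure_completion)
  also have "\<dots> = measure lebesgue (\<Union>i\<in>I. {l i<..<r i})"
    using assms by (intro measure_finite_Union[symmetric]) (auto simp: emeasure_completion)
  also have "\<dots> \<le> measure lebesgue U"
    using assms by (intro measure_mono_fmeasurable) auto
  finally show ?thesis .
qed

text \<open>Cousin's lemma: around points of differentiability the gauge controls the increments through
  the derivative, around the exceptional null set it makes them small by absolute continuity.\<close>

lemma absolutely_continuous_on_Icc_nonincreasing: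
  fixes g :: "real \<Rightarrow> real"
  assumes "a \<le> b" and ac: "absolutely_continuous_on_Icc a b g"
    and N: "negligible N"
    and der: "\<And>t. t \<in> {a..b} - N \<Longrightarrow> \<exists>d\<le>0. (g has_real_derivative d) (at t within {a..b})"
  shows "g b \<le> g a"
proof (rule field_le_epsilon)
  fix e0 :: real assume "0 < e0"
  \<comment> \<open>The increments over intervals tagged in \<open>N\<close> will cost at most
    \<open>e\<close>, the others \<open>e * (b - a)\<close>; the denominator makes the total
    \<open>e0\<close>.\<close>
  define e where "e = e0 / (1 + (b - a))"
  have "e > 0" using \<open>a \<le> b\<close> \<open>0 < e0\<close> by (simp add: e_def)
  \<comment> \<open>The pairs of tag and interval serve as indices themselves, so the division need
    not be numbered.\<close>
  obtain d where "d > 0" and d: "\<forall>(I :: (real \<times> real set) set) l r. finite I \<longrightarrow> (\<forall>i\<in>I. a \<le> l i \<and> l i \<le> r i \<and> r i \<le> b) \<longrightarrow>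
      disjoint_family_on (\<lambda>i. {l i<..<r i}) I \<longrightarrow> (\<Sum>i\<in>I. r i - l i) < d \<longrightarrow>
      (\<Sum>i\<in>I. norm (g (r i) - g (l i))) < e"
    using absolutely_continuous_on_Icc_finite_family[OF ac \<open>0 < e\<close>, where ?'i = "real \<times> real set"] by blast
  have "N \<in> sets lebesgue"
    using N negligible_imp_sets by blast
  then obtain U where U: "open U" "N \<subseteq> U" "U - N \<in> lmeasurable" "emeasure lebesgue (U - N) < ennreal d"
    using sets_lebesgue_outer_open \<open>d > 0\<close> by metis
  have "U \<in> lmeasurable" "measure lebesgue U < d"
  proof -
    have eq: "U = (U - N) \<union> N" using U(2) by blast
    have "N \<in> lmeasurable" using N negligible_imp_measurable by blast
    then show "U \<in> lmeasurable" using U(3) eq by (metis fmeasurable.Un)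
    have "emeasure lebesgue U \<le> emeasure lebesgue (U - N) + emeasure lebesgue N"
      using U(3) \<open>N \<in> sets lebesgue\<close> by (subst eq, intro emeasure_subadditive) auto
    also have "emeasure lebesgue N = 0"
      using N by (simp add: negligible_iff_emeasure0 \<open>N \<in> sets lebesgue\<close>)
    finally have "emeasure lebesgue U < ennreal d" using U(4) by simp
    then show "measure lebesgue U < d"
      using \<open>d > 0\<close> unfolding measure_def by (metis enn2real_less_iff ennreal_less_top less_trans order_less_le)
  qed
  \<comment> \<open>The estimate is taken on each side of \<open>t\<close> because a tag lies inside
    its interval: the increment over the interval will be split at the tag.\<close>
  have "\<exists>\<rho>>0. \<forall>y\<in>{a..b}. \<bar>y - t\<bar> < \<rho> \<longrightarrow> (t \<le> y \<longrightarrow> g y - g t \<le> e * (y - t)) \<and> (y \<le> t \<longrightarrow> g t - g y \<le> e * (t - y))"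
    if t: "t \<in> {a..b} - N" for t
  proof -
    obtain D where "D \<le> 0" and D: "(g has_derivative (\<lambda>h. D * h)) (at t within {a..b})"
      using der[OF t] by (auto simp: has_field_derivative_def)
    obtain \<rho> where \<rho>: "\<rho> > 0" "\<And>y. y \<in> {a..b} \<Longrightarrow> norm (y - t) < \<rho> \<Longrightarrow> norm (g y - g t - D * (y - t)) \<le> e * norm (y - t)"
      using D \<open>e > 0\<close> unfolding has_derivative_within_alt by (metis)
    have "(t \<le> y \<longrightarrow> g y - g t \<le> e * (y - t)) \<and> (y \<le> t \<longrightarrow> g t - g y \<le> e * (t - y))"
      if y: "y \<in> {a..b}" "\<bar>y - t\<bar> < \<rho>" for y
    proof -
      have 1: "\<bar>g y - g t - D * (y - t)\<bar> \<le> e * \<bar>y - t\<bar>" using \<rho>(2)[OF y(1)] y(2) by simp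
      have "t \<le> y \<Longrightarrow> D * (y - t) \<le> 0" "y \<le> t \<Longrightarrow> 0 \<le> D * (y - t)"
        using \<open>D \<le> 0\<close> by (auto simp: mult_nonpos_nonneg mult_nonpos_nonpos)
      with 1 show ?thesis by (auto simp: abs_if algebra_simps split: if_splits)
    qed
    with \<rho>(1) show ?thesis by blast
  qed
  then obtain \<rho> where \<rho>: "\<And>t. t \<in> {a..b} - N \<Longrightarrow> \<rho> t > 0"
    "\<And>t y. t \<in> {a..b} - N \<Longrightarrow> y \<in> {a..b} \<Longrightarrow> \<bar>y - t\<bar> < \<rho> t \<Longrightarrow>
       (t \<le> y \<longrightarrow> g y - g t \<le> e * (y - t)) \<and> (y \<le> t \<longrightarrow> g t - g y \<le> e * (t - y))"
    by metis
  \<comment> \<open>A tag in \<open>N\<close> confines its interval to \<open>U\<close>, whose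
    measure is below \<open>d\<close>, so absolute continuity applies to all such intervals at once.
    The unit ball outside [a, b] makes \<open>\<gamma>\<close> a gauge on the whole line.\<close>
  define \<gamma> where "\<gamma> = (\<lambda>t. if t \<in> N then U else if t \<in> {a..b} then ball t (\<rho> t) else ball t 1)"
  have "gauge \<gamma>"
    unfolding gauge_def \<gamma>_def using U \<rho>(1) by auto
  then obtain p where p: "p tagged_division_of {a..b}" "\<gamma> fine p"
    using fine_division_exists_real by metis
  have fin: "finite p" using p(1) by blast
  have pK: "x \<in> {a..b} \<and> x \<in> K \<and> a \<le> Inf K \<and> Inf K \<le> x \<and> x \<le> Sup K \<and> Sup K \<le> b \<and>
      K = {Inf K..Sup K} \<and> {Inf K<..<Sup K} = interior K \<and> K \<subseteq> \<gamma> x"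
    if xK: "(x, K) \<in> p" for x K
  proof -
    have K: "x \<in> K" "K \<subseteq> {a..b}" "K \<subseteq> \<gamma> x"
      using p xK by (auto simp: fine_def dest: tagged_division_ofD)
    obtain u v where uv: "K = cbox u v" using tagged_division_ofD(4)[OF p(1) xK] by blast
    then have "u \<le> v" "K = {u..v}" using K(1) by auto
    then show ?thesis using K by auto
  qed
  define q where "q = {i \<in> p. fst i \<in> N}"
  have "g b - g a = (\<Sum>(x,K)\<in>p. g (Sup K) - g (Inf K))"
    using additive_tagged_division_1[OF \<open>a \<le> b\<close> p(1), of g] by simp
  also have "\<dots> = (\<Sum>i\<in>p - q. g (Sup (snd i)) - g (Inf (snd i))) + (\<Sum>i\<in>q. g (Sup (snd i)) - g (Inf (snd i)))"
    using fin by (subst sum.subset_diff[of q p]) (auto simp: q_def case_prod_unfold)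
  also have "(\<Sum>i\<in>q. g (Sup (snd i)) - g (Inf (snd i))) \<le> (\<Sum>i\<in>q. norm (g (Sup (snd i)) - g (Inf (snd i))))"
    by (intro sum_mono) auto
  also have "\<dots> \<le> e"
  proof (rule less_imp_le, rule d[rule_format])
    show "finite q" using fin by (simp add: q_def)
    show bd: "\<And>i. i \<in> q \<Longrightarrow> a \<le> Inf (snd i) \<and> Inf (snd i) \<le> Sup (snd i) \<and> Sup (snd i) \<le> b"
      using pK by (force simp: q_def)
    show dis: "disjoint_family_on (\<lambda>i. {Inf (snd i)<..<Sup (snd i)}) q"
      unfolding disjoint_family_on_def
    proof (intro ballI impI)
      fix i j assume ij: "i \<in> q" "j \<in> q" "i \<noteq> j"
      obtain x K x' K' where "i = (x, K)" "j = (x', K')" by (metis surj_pair)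
      then show "{Inf (snd i)<..<Sup (snd i)} \<inter> {Inf (snd j)<..<Sup (snd j)} = {}"
        using tagged_division_ofD(5)[OF p(1), of x K x' K'] ij pK[of x K] pK[of x' K']
        by (auto simp: q_def)
    qed
    have "(\<Sum>i\<in>q. Sup (snd i) - Inf (snd i)) \<le> measure lebesgue U"
    proof (rule sum_length_le_measure[OF \<open>finite q\<close> dis _ _ \<open>U \<in> lmeasurable\<close>])
      fix i assume i: "i \<in> q"
      then show "Inf (snd i) \<le> Sup (snd i)" using bd by blast
      show "{Inf (snd i)<..<Sup (snd i)} \<subseteq> U"
        using i pK[of "fst i" "snd i"] interior_subset[of "snd i"] by (auto simp: q_def \<gamma>_def)
    qed
    also have "\<dots> < d" by fact
    finally show "(\<Sum>i\<in>q. Sup (snd i) - Inf (snd i)) < d" .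
  qed
  also have "(\<Sum>i\<in>p - q. g (Sup (snd i)) - g (Inf (snd i))) \<le> (\<Sum>i\<in>p - q. e * (Sup (snd i) - Inf (snd i)))"
  proof (rule sum_mono)
    fix i assume i: "i \<in> p - q"
    obtain x K where xK: "i = (x, K)" by (metis surj_pair)
    have pk: "(x, K) \<in> p" "x \<notin> N" using i xK by (auto simp: q_def)
    note P = pK[OF pk(1)]
    have x: "x \<in> {a..b} - N" using P pk by auto
    have mem: "Sup K \<in> \<gamma> x" "Inf K \<in> \<gamma> x" using P by (metis atLeastAtMost_iff order_refl order_trans subsetD)+
    then have "\<bar>Sup K - x\<bar> < \<rho> x" "\<bar>Inf K - x\<bar> < \<rho> x"
      using x by (auto simp: \<gamma>_def dist_real_def abs_minus_commute)
    then have "g (Sup K) - g x \<le> e * (Sup K - x)" "g x - g (Inf K) \<le> e * (x - Inf K)"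
      using \<rho>(2)[OF x] P by auto
    then have "g (Sup K) - g (Inf K) \<le> e * (Sup K - Inf K)" by (simp add: algebra_simps)
    then show "g (Sup (snd i)) - g (Inf (snd i)) \<le> e * (Sup (snd i) - Inf (snd i))" using xK by simp
  qed
  also have "\<dots> \<le> (\<Sum>i\<in>p. e * (Sup (snd i) - Inf (snd i)))"
    by (rule sum_mono2) (use fin \<open>e > 0\<close> pK in \<open>force+\<close>)
  also have "\<dots> = e * (b - a)"
    using additive_tagged_division_1[OF \<open>a \<le> b\<close> p(1), of "\<lambda>x. x"]
    by (simp add: sum_distrib_left[symmetric] case_prod_unfold)
  finally have "g b - g a \<le> e * (1 + (b - a))" by (simp add: algebra_simps)
  also have "\<dots> = e0" using \<open>a \<le> b\<close> by (simp add: e_def)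
  finally show "g b \<le> g a + e0" by simp
qed

section \<open>Criteria for absolute continuity and differential inequalities\<close>

lemma absolutely_continuous_on_Icc_lipschitz:
  assumes "\<And>x y. a \<le> x \<Longrightarrow> x \<le> y \<Longrightarrow> y \<le> b \<Longrightarrow> norm (f y - f x) \<le> L * (y - x)"
  shows "absolutely_continuous_on_Icc a b f"
  unfolding absolutely_continuous_on_Icc_def
proof (intro allI impI)
  fix e :: real assume "0 < e"
  define M where "M = max L 1"
  have "M > 0" by (simp add: M_def)
  have le: "norm (f y - f x) \<le> M * (y - x)" if "a \<le> x" "x \<le> y" "y \<le> b" for x y
    by (rule order_trans[OF assms[OF that]]) (use that in \<open>auto simp: M_def intro: mult_right_mono\<close>)
  show "\<exists>\<delta>>0. \<forall>(n::nat) s t. (\<forall>i<n. a \<le> s i \<and> s i \<le> t i \<and> t i \<le> b) \<and>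
      disjoint_family_on (\<lambda>i. {s i<..<t i}) {..<n} \<and> (\<Sum>i<n. t i - s i) < \<delta> \<longrightarrow>
      (\<Sum>i<n. norm (f (t i) - f (s i))) < e"
  proof (intro exI[of _ "e / M"] conjI allI impI)
    fix n :: nat and s t :: "nat \<Rightarrow> real"
    assume *: "(\<forall>i<n. a \<le> s i \<and> s i \<le> t i \<and> t i \<le> b) \<and>
      disjoint_family_on (\<lambda>i. {s i<..<t i}) {..<n} \<and> (\<Sum>i<n. t i - s i) < e / M"
    have "(\<Sum>i<n. norm (f (t i) - f (s i))) \<le> (\<Sum>i<n. M * (t i - s i))"
      using * by (intro sum_mono le) auto
    also have "\<dots> = M * (\<Sum>i<n. t i - s i)" by (simp add: sum_distrib_left)
    also have "\<dots> < e" using * \<open>M > 0\<close> by (simp add: field_simps)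
    finally show "(\<Sum>i<n. norm (f (t i) - f (s i))) < e" .
  qed (use \<open>0 < e\<close> \<open>M > 0\<close> in auto)
qed

lemma lipschitz_on_imp_absolutely_continuous_on_Icc:
  assumes "L-lipschitz_on {a..b} f"
  shows "absolutely_continuous_on_Icc a b f"
proof (rule absolutely_continuous_on_Icc_lipschitz)
  fix x y assume "a \<le> x" "x \<le> y" "y \<le> b"
  then show "norm (f y - f x) \<le> L * (y - x)"
    using lipschitz_on_normD[OF assms, of y x] by simp
qed

lemma C1_imp_lipschitz_on:
  fixes f :: "real \<Rightarrow> 'a::real_normed_vector"
  assumes "\<And>t. t \<in> {a..b} \<Longrightarrow> (f has_vector_derivative f' t) (at t within {a..b})"
    and "continuous_on {a..b} f'"
  shows "\<exists>L. L-lipschitz_on {a..b} f"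
proof -
  have "bounded (f' ` {a..b})"
    using assms(2) by (intro compact_imp_bounded compact_continuous_image) auto
  then obtain L where L: "L > 0" "\<And>t. t \<in> {a..b} \<Longrightarrow> norm (f' t) \<le> L"
    unfolding bounded_pos by auto
  have "L-lipschitz_on {a..b} f"
  proof (rule bounded_derivative_imp_lipschitz)
    fix t assume t: "t \<in> {a..b}"
    show "(f has_derivative (\<lambda>h. h *\<^sub>R f' t)) (at t within {a..b})"
      using assms(1)[OF t] by (simp add: has_vector_derivative_def)
    show "onorm (\<lambda>h. h *\<^sub>R f' t) \<le> L"
      using mult_right_mono[OF L(2)[OF t] abs_ge_zero] by (intro onorm_le) (simp add: mult.commute)
  qed (use L in auto)
  then show ?thesis by blast
qed

lemma absolutely_continuous_on_Icc_subset:
  assumes "absolutely_continuous_on_Icc a b f" "a \<le> c" "d \<le> b"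
  shows "absolutely_continuous_on_Icc c d f"
  unfolding absolutely_continuous_on_Icc_def
proof (intro allI impI)
  fix e :: real assume "0 < e"
  then obtain \<delta> where "\<delta> > 0" and \<delta>: "\<forall>(n::nat) s t.
        (\<forall>i<n. a \<le> s i \<and> s i \<le> t i \<and> t i \<le> b) \<and>
        disjoint_family_on (\<lambda>i. {s i<..<t i}) {..<n} \<and>
        (\<Sum>i<n. t i - s i) < \<delta> \<longrightarrow>
        (\<Sum>i<n. norm (f (t i) - f (s i))) < e"
    using assms(1) unfolding absolutely_continuous_on_Icc_def by blast
  show "\<exists>\<delta>>0. \<forall>(n::nat) s t. (\<forall>i<n. c \<le> s i \<and> s i \<le> t i \<and> t i \<le> d) \<and>
      disjoint_family_on (\<lambda>i. {s i<..<t i}) {..<n} \<and> (\<Sum>i<n. t i - s i) < \<delta> \<longrightarrow>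
      (\<Sum>i<n. norm (f (t i) - f (s i))) < e"
  proof (intro exI[of _ \<delta>] conjI allI impI \<open>\<delta> > 0\<close>)
    fix n :: nat and s t :: "nat \<Rightarrow> real"
    assume *: "(\<forall>i<n. c \<le> s i \<and> s i \<le> t i \<and> t i \<le> d) \<and>
      disjoint_family_on (\<lambda>i. {s i<..<t i}) {..<n} \<and> (\<Sum>i<n. t i - s i) < \<delta>"
    moreover have "\<forall>i<n. a \<le> s i \<and> s i \<le> t i \<and> t i \<le> b"
      using * assms(2,3) by (meson order_trans)
    ultimately show "(\<Sum>i<n. norm (f (t i) - f (s i))) < e" using \<delta> by blast
  qed
qed

text \<open>Differences and bilinear products are both reduced to a bound on increments, tested for
  all three functions on the same family of intervals.\<close>

lemma absolutely_continuous_on_Icc_dominated: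
  assumes f: "absolutely_continuous_on_Icc a b f" and g: "absolutely_continuous_on_Icc a b g"
    and le: "\<And>x y. a \<le> x \<Longrightarrow> x \<le> y \<Longrightarrow> y \<le> b \<Longrightarrow>
      norm (h y - h x) \<le> M * (norm (f y - f x) + norm (g y - g x))"
  shows "absolutely_continuous_on_Icc a b h"
  unfolding absolutely_continuous_on_Icc_def
proof (intro allI impI)
  fix e :: real assume "0 < e"
  \<comment> \<open>\<open>M\<close> may be zero or negative; \<open>K\<close> is at least
    \<open>M\<close> and can be divided by.\<close>
  define K where "K = max M 1"
  have "K > 0" by (simp add: K_def)
  have le': "norm (h y - h x) \<le> K * (norm (f y - f x) + norm (g y - g x))" if "a \<le> x" "x \<le> y" "y \<le> b" for x y
    by (rule order_trans[OF le[OF that]]) (auto simp: K_def intro: mult_right_mono)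
  have D: "0 < e / (2 * K)" using \<open>0 < e\<close> \<open>K > 0\<close> by simp
  obtain \<delta> where "\<delta> > 0" and \<delta>: "\<forall>(n::nat) s t.
        (\<forall>i<n. a \<le> s i \<and> s i \<le> t i \<and> t i \<le> b) \<and>
        disjoint_family_on (\<lambda>i. {s i<..<t i}) {..<n} \<and>
        (\<Sum>i<n. t i - s i) < \<delta> \<longrightarrow>
        (\<Sum>i<n. norm (f (t i) - f (s i))) < e / (2 * K)"
    using f D unfolding absolutely_continuous_on_Icc_def by blast
  obtain \<delta>' where "\<delta>' > 0" and \<delta>': "\<forall>(n::nat) s t.
        (\<forall>i<n. a \<le> s i \<and> s i \<le> t i \<and> t i \<le> b) \<and>
        disjoint_family_on (\<lambda>i. {s i<..<t i}) {..<n} \<and>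
        (\<Sum>i<n. t i - s i) < \<delta>' \<longrightarrow>
        (\<Sum>i<n. norm (g (t i) - g (s i))) < e / (2 * K)"
    using g D unfolding absolutely_continuous_on_Icc_def by blast
  show "\<exists>\<delta>>0. \<forall>(n::nat) s t. (\<forall>i<n. a \<le> s i \<and> s i \<le> t i \<and> t i \<le> b) \<and>
      disjoint_family_on (\<lambda>i. {s i<..<t i}) {..<n} \<and> (\<Sum>i<n. t i - s i) < \<delta> \<longrightarrow>
      (\<Sum>i<n. norm (h (t i) - h (s i))) < e"
  proof (intro exI[of _ "min \<delta> \<delta>'"] conjI allI impI)
    show "0 < min \<delta> \<delta>'" using \<open>\<delta> > 0\<close> \<open>\<delta>' > 0\<close> by simp
    fix n :: nat and s t :: "nat \<Rightarrow> real"
    assume *: "(\<forall>i<n. a \<le> s i \<and> s i \<le> t i \<and> t i \<le> b) \<and>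
      disjoint_family_on (\<lambda>i. {s i<..<t i}) {..<n} \<and> (\<Sum>i<n. t i - s i) < min \<delta> \<delta>'"
    have 1: "(\<Sum>i<n. norm (f (t i) - f (s i))) < e / (2 * K)" using * \<delta> by simp
    have 2: "(\<Sum>i<n. norm (g (t i) - g (s i))) < e / (2 * K)" using * \<delta>' by simp
    have "(\<Sum>i<n. norm (h (t i) - h (s i))) \<le> (\<Sum>i<n. K * (norm (f (t i) - f (s i)) + norm (g (t i) - g (s i))))"
      using * by (intro sum_mono le') auto
    also have "\<dots> = K * ((\<Sum>i<n. norm (f (t i) - f (s i))) + (\<Sum>i<n. norm (g (t i) - g (s i))))"
      by (simp add: sum_distrib_left[symmetric] sum.distrib)
    also have "\<dots> < K * (e / (2 * K) + e / (2 * K))"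
      using 1 2 \<open>K > 0\<close> by (intro mult_strict_left_mono add_strict_mono)
    also have "\<dots> = e" using \<open>K > 0\<close> by (simp add: field_simps)
    finally show "(\<Sum>i<n. norm (h (t i) - h (s i))) < e" .
  qed
qed

lemma absolutely_continuous_on_Icc_diff:
  assumes "absolutely_continuous_on_Icc a b f" "absolutely_continuous_on_Icc a b g"
  shows "absolutely_continuous_on_Icc a b (\<lambda>t. f t - g t)"
  by (rule absolutely_continuous_on_Icc_dominated[OF assms, where M = 1])
     (metis add_diff_add norm_triangle_ineq4 add_diff_eq diff_diff_eq2 diff_add_eq mult_1)

text \<open>The increment splits as in the product rule, and continuity on the compact interval
  bounds the factor that is not differenced.\<close>

lemma (in bounded_bilinear) absolutely_continuous_on_Icc:
  assumes f: "absolutely_continuous_on_Icc a b f" and g: "absolutely_continuous_on_Icc a b g"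
  shows "absolutely_continuous_on_Icc a b (\<lambda>t. prod (f t) (g t))"
proof -
  obtain B where "B > 0" and B: "\<And>x. x \<in> {a..b} \<Longrightarrow> norm (f x) \<le> B"
    using compact_continuous_image[OF absolutely_continuous_on_Icc_imp_continuous_on[OF f] compact_Icc]
    by (metis compact_imp_bounded bounded_pos imageI)
  obtain C where "C > 0" and C: "\<And>x. x \<in> {a..b} \<Longrightarrow> norm (g x) \<le> C"
    using compact_continuous_image[OF absolutely_continuous_on_Icc_imp_continuous_on[OF g] compact_Icc]
    by (metis compact_imp_bounded bounded_pos imageI)
  obtain K where "K \<ge> 0" and K: "\<And>x y. norm (prod x y) \<le> norm x * norm y * K"
    using nonneg_bounded by blast
  show ?thesis
  proof (rule absolutely_continuous_on_Icc_dominated[OF f g, where M = "K * max B C"])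
    fix x y assume xy: "a \<le> x" "x \<le> y" "y \<le> b"
    have "prod (f y) (g y) - prod (f x) (g x) = prod (f y - f x) (g y) + prod (f x) (g y - g x)"
      by (simp add: diff_left diff_right)
    then have "norm (prod (f y) (g y) - prod (f x) (g x))
        \<le> norm (prod (f y - f x) (g y)) + norm (prod (f x) (g y - g x))"
      by (metis norm_triangle_ineq)
    also have "\<dots> \<le> norm (f y - f x) * norm (g y) * K + norm (f x) * norm (g y - g x) * K"
      by (intro add_mono K)
    also have "\<dots> \<le> norm (f y - f x) * max B C * K + max B C * norm (g y - g x) * K"
      using B[of x] C[of y] xy \<open>K \<ge> 0\<close>
      by (intro add_mono mult_right_mono mult_left_mono) (auto simp: le_max_iff_disj)
    finally show "norm (prod (f y) (g y) - prod (f x) (g x))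
        \<le> K * max B C * (norm (f y - f x) + norm (g y - g x))"
      by (simp add: algebra_simps)
  qed
qed

lemma absolutely_continuous_on_Icc_const: "absolutely_continuous_on_Icc a b (\<lambda>_. c)"
  by (rule absolutely_continuous_on_Icc_lipschitz[where L = 0]) simp

lemma absolutely_continuous_on_Icc_constant:
  fixes f :: "real \<Rightarrow> 'a::real_inner"
  assumes "a \<le> b" "absolutely_continuous_on_Icc a b f" "negligible N"
    and der: "\<And>t. t \<in> {a..b} - N \<Longrightarrow> (f has_vector_derivative 0) (at t within {a..b})"
  shows "f b = f a"
proof -
  \<comment> \<open>Pairing \<open>f\<close> with its own total increment gives a real function with
    derivative 0 off \<open>N\<close>, and a single monotonicity inequality already forces v . v <=
    0.\<close>
  define v where "v = f b - f a"
  have "f b \<bullet> v \<le> f a \<bullet> v"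
  proof (rule absolutely_continuous_on_Icc_nonincreasing[OF \<open>a \<le> b\<close> _ \<open>negligible N\<close>])
    show "absolutely_continuous_on_Icc a b (\<lambda>t. f t \<bullet> v)"
      by (rule bounded_bilinear.absolutely_continuous_on_Icc[OF bounded_bilinear_inner])
         (use assms in \<open>auto intro: absolutely_continuous_on_Icc_const\<close>)
    fix t assume "t \<in> {a..b} - N"
    note d = der[OF this]
    have "((\<lambda>t. f t \<bullet> v) has_vector_derivative 0 \<bullet> v) (at t within {a..b})"
      by (rule bounded_linear.has_vector_derivative[OF bounded_linear_inner_left d])
    then show "\<exists>d\<le>0. ((\<lambda>t. f t \<bullet> v) has_real_derivative d) (at t within {a..b})"
      by (auto simp: has_real_derivative_iff_has_vector_derivative)
  qed
  then have "v \<bullet> v \<le> 0" by (simp add: v_def inner_diff_left)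
  then have "v = 0" by (metis inner_ge_zero inner_eq_zero_iff order_antisym)
  then show ?thesis by (simp add: v_def)
qed

text \<open>The product with the integrating factor exp (- c t) is nonincreasing, whatever the signs
  of \<open>c\<close> and \<open>g\<close>.\<close>

lemma absolutely_continuous_on_Icc_gronwall:
  fixes g :: "real \<Rightarrow> real"
  assumes "a \<le> b" "absolutely_continuous_on_Icc a b g" "negligible N"
    and der: "\<And>t. t \<in> {a..b} - N \<Longrightarrow> \<exists>d. d \<le> c * g t \<and> (g has_real_derivative d) (at t within {a..b})"
    and "g a \<le> 0"
  shows "g b \<le> 0"
proof -
  have "exp (- c * b) * g b \<le> exp (- c * a) * g a"
  proof (rule absolutely_continuous_on_Icc_nonincreasing[OF \<open>a \<le> b\<close> _ \<open>negligible N\<close>])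
    have "\<exists>L. L-lipschitz_on {a..b} (\<lambda>t. exp (- c * t))"
      by (rule C1_imp_lipschitz_on[where f' = "\<lambda>t. exp (- c * t) * - c"])
         (auto intro!: continuous_intros derivative_eq_intros
           simp: has_real_derivative_iff_has_vector_derivative[symmetric])
    then have "absolutely_continuous_on_Icc a b (\<lambda>t. exp (- c * t))"
      using lipschitz_on_imp_absolutely_continuous_on_Icc by blast
    then show "absolutely_continuous_on_Icc a b (\<lambda>t. exp (- c * t) * g t)"
      by (rule bounded_bilinear.absolutely_continuous_on_Icc[OF bounded_bilinear_mult]) fact
    fix t assume "t \<in> {a..b} - N"
    from der[OF this] obtain d where d: "d \<le> c * g t" "(g has_real_derivative d) (at t within {a..b})"
      by blast
    have "((\<lambda>t. exp (- c * t) * g t) has_real_derivative exp (- c * t) * (d - c * g t)) (at t within {a..b})"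
      using d(2) by (auto intro!: derivative_eq_intros simp: algebra_simps)
    moreover have "exp (- c * t) * (d - c * g t) \<le> 0"
      using d(1) by (intro mult_nonneg_nonpos) auto
    ultimately show "\<exists>d\<le>0. ((\<lambda>t. exp (- c * t) * g t) has_real_derivative d) (at t within {a..b})"
      by blast
  qed
  also have "\<dots> \<le> 0" using \<open>g a \<le> 0\<close> by (intro mult_nonneg_nonpos) auto
  finally show ?thesis by (simp add: mult_le_0_iff)
qed

lemma AE_lebesgue_on_iff_negligible:
  assumes "J \<in> sets lebesgue"
  shows "(AE t in lebesgue_on J. P t) \<longleftrightarrow> (\<exists>N. negligible N \<and> (\<forall>t\<in>J - N. P t))"
proof -
  have "(AE t in lebesgue_on J. P t) \<longleftrightarrow> (AE t in lebesgue. t \<in> J \<longrightarrow> P t)"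
    using assms by (simp add: AE_restrict_space_iff)
  also have "\<dots> \<longleftrightarrow> (\<exists>N. negligible N \<and> (\<forall>t\<in>J - N. P t))"
    unfolding eventually_ae_filter negligible_iff_null_sets by auto
  finally show ?thesis .
qed

section \<open>Linear equations with measurable coefficients\<close>

lemma bounded_bilinear_matrix_mult:
  "bounded_bilinear ((**) :: real^'n^'m \<Rightarrow> real^'p^'n \<Rightarrow> real^'p^'m)"
  unfolding bilinear_conv_bounded_bilinear[symmetric] bilinear_def linear_iff
  by (auto simp: matrix_matrix_mult_def vec_eq_iff sum.distrib sum_distrib_left algebra_simps)

text \<open>The differentiation theorem is applied twice: to \<open>f\<close> for the quotients from
  the right, and to x -> f (- x) for those from the left, since at t > 0 the derivative within the
  half-line is two-sided.\<close>

lemma indefinite_integral_has_vector_derivative_AE: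
  fixes h :: "real \<Rightarrow> 'b::euclidean_space"
  assumes int: "\<And>T. h integrable_on {0..T}"
  obtains N where "negligible N"
    "\<And>t. t \<in> {0..} - N \<Longrightarrow> ((\<lambda>t. integral {0..t} h) has_vector_derivative h t) (at t within {0..})"
proof -
  define f where "f = (\<lambda>x. if x \<in> {0..} then h x else 0)"
  have f: "f integrable_on {a..b}" for a b
  proof -
    have "h integrable_on {max a 0..b}"
      using integrable_on_subinterval[OF int[of b], of "max a 0" b] by auto
    also have "{max a 0..b} = {a..b} \<inter> {0..}" by auto
    finally show ?thesis
      unfolding f_def integrable_restrict_Int[of "{0..}" h] by (simp add: Int_commute)
  qed
  then have "f integrable_on cbox a b" for a b by simp
  from integrable_ccontinuous_explicit[OF this] obtain N1 where N1: "negligible N1"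
    "\<And>x e. \<lbrakk>x \<notin> N1; 0 < e\<rbrakk> \<Longrightarrow> \<exists>d>0. \<forall>k. 0 < k \<and> k < d \<longrightarrow>
       norm (integral {x..x + k} f /\<^sub>R k - f x) < e"
    by auto
  have "(\<lambda>x. f (- x)) integrable_on cbox a b" for a b
    using f[of "-b" "-a"] Henstock_Kurzweil_Integration.integrable_reflect_real[where f = f and a = "-b" and b = "-a"] by simp
  from integrable_ccontinuous_explicit[OF this] obtain N2 where N2: "negligible N2"
    "\<And>x e. \<lbrakk>x \<notin> N2; 0 < e\<rbrakk> \<Longrightarrow> \<exists>d>0. \<forall>k. 0 < k \<and> k < d \<longrightarrow>
       norm (integral {x..x + k} (\<lambda>x. f (- x)) /\<^sub>R k - f (- x)) < e"
    by auto
  \<comment> \<open>At 0 the left intervals leave the half-line and the extension by zero may jump,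
    so this point joins the exceptional set.\<close>
  define N where "N = N1 \<union> uminus ` N2 \<union> {0}"
  have "negligible (uminus ` N2)"
    by (rule negligible_differentiable_image_negligible[OF _ N2(1)])
       (auto intro: linear_imp_differentiable_on linear_uminus)
  then have "negligible N"
    using N1(1) by (auto simp: N_def)
  moreover have "((\<lambda>t. integral {0..t} h) has_vector_derivative h t) (at t within {0..})" if t: "t \<in> {0..} - N" for t
    unfolding has_vector_derivative_def has_derivative_within_alt
  proof (intro conjI allI impI bounded_linear_scaleR_left)
    fix e :: real assume "0 < e"
    have "t > 0" "t \<notin> N1" "- t \<notin> N2" using t by (auto simp: N_def image_iff)
    obtain d1 where d1: "d1 > 0" "\<And>k. 0 < k \<Longrightarrow> k < d1 \<Longrightarrow> norm (integral {t..t + k} f /\<^sub>R k - f t) < e"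
      using N1(2)[OF \<open>t \<notin> N1\<close> \<open>0 < e\<close>] by auto
    obtain d2 where d2: "d2 > 0"
      "\<And>k. 0 < k \<Longrightarrow> k < d2 \<Longrightarrow> norm (integral {-t..-t + k} (\<lambda>x. f (- x)) /\<^sub>R k - f t) < e"
      using N2(2)[OF \<open>- t \<notin> N2\<close> \<open>0 < e\<close>] by auto
    have eqh: "integral {a..b} h = integral {a..b} f" if "0 \<le> a" for a b
      using that by (intro integral_cong) (auto simp: f_def)
    have diff: "integral {0..y} h - integral {0..x} h = integral {x..y} f" if "0 \<le> x" "x \<le> y" for x y
      using Henstock_Kurzweil_Integration.integral_combine[OF that int[of y]] eqh[of x y] that by (simp add: algebra_simps)
    have scale: "norm (I - k *\<^sub>R v) \<le> e * k" if "norm (I /\<^sub>R k - v) < e" "0 < k" for I v and k :: real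
    proof -
      have "I - k *\<^sub>R v = k *\<^sub>R (I /\<^sub>R k - v)" using that by (simp add: scaleR_diff_right)
      then have "norm (I - k *\<^sub>R v) = k * norm (I /\<^sub>R k - v)" using that by simp
      also have "\<dots> \<le> k * e" using that by (intro mult_left_mono) auto
      finally show ?thesis by (simp add: mult.commute)
    qed
    have "norm (integral {0..y} h - integral {0..t} h - (y - t) *\<^sub>R h t) \<le> e * norm (y - t)"
      if y: "y \<in> {0..}" "norm (y - t) < min d1 d2" for y
    proof -
      have ft: "f t = h t" using \<open>t > 0\<close> by (simp add: f_def)
      consider "y = t" | "y > t" | "y < t" by linarith
      then show ?thesis
      proof cases
        case 2
        then have "norm (integral {t..y} f - (y - t) *\<^sub>R h t) \<le> e * (y - t)"
          using scale[OF d1(2)[of "y - t"]] y by (simp add: ft)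
        then show ?thesis using diff[of t y] 2 \<open>t > 0\<close> by simp
      next
        case 3
        have "integral {-t..-y} (\<lambda>x. f (- x)) = integral {y..t} f"
          by (rule Henstock_Kurzweil_Integration.integral_reflect_real)
        then have "norm (integral {y..t} f - (t - y) *\<^sub>R h t) \<le> e * (t - y)"
          using scale[OF d2(2)[of "t - y"]] y 3 by (simp add: ft)
        moreover have "integral {0..y} h - integral {0..t} h - (y - t) *\<^sub>R h t = - (integral {y..t} f - (t - y) *\<^sub>R h t)"
          using diff[of y t] 3 y by (simp add: algebra_simps)
        moreover have "norm (y - t) = t - y" using 3 by simp
        ultimately show ?thesis by (simp only: norm_minus_cancel)
      qed auto
    qed
    then show "\<exists>d>0. \<forall>y\<in>{0..}. norm (y - t) < d \<longrightarrow>
        norm (integral {0..y} h - integral {0..t} h - (y - t) *\<^sub>R h t) \<le> e * norm (y - t)"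
      using d1(1) d2(1) by (intro exI[of _ "min d1 d2"]) auto
  qed
  ultimately show thesis using that by blast
qed

text \<open>The solution is the Peano--Baker series, the sum of the iterated integrals \<open>X n\<close>.\<close>

lemma linear_ode_exists:
  fixes w :: "real \<Rightarrow> real^'n^'n" and R0 :: "real^'n^'m"
  assumes meas: "w \<in> borel_measurable (lebesgue_on {0..})"
    and bounded: "\<And>T. \<exists>B. \<forall>t\<in>{0..T}. norm (w t) \<le> B"
  obtains R N where "R 0 = R0" "\<And>T. \<exists>L. L-lipschitz_on {0..T} R" "negligible N"
    "\<And>t. t \<in> {0..} - N \<Longrightarrow> (R has_vector_derivative R t ** w t) (at t within {0..})"
proof -
  obtain K :: real where "K > 0"
    and K: "\<And>(x :: real^'n^'m) (y :: real^'n^'n). norm (x ** y) \<le> norm x * norm y * K"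
    using bounded_bilinear.pos_bounded[OF bounded_bilinear_matrix_mult] by blast
  have int: "(\<lambda>s. f s ** w s) integrable_on {0..T}" if f: "continuous_on {0..T} f"
    for f :: "real \<Rightarrow> real^'n^'m" and T
  proof -
    obtain B where B: "\<forall>t\<in>{0..T}. norm (w t) \<le> B" using bounded by blast
    have "bounded (f ` {0..T})" using f by (intro compact_imp_bounded compact_continuous_image) auto
    then obtain C where C: "\<And>t. t \<in> {0..T} \<Longrightarrow> norm (f t) \<le> C" "C > 0"
      unfolding bounded_pos by (meson imageI)
    show ?thesis
    proof (rule measurable_bounded_by_integrable_imp_integrable)
      have fm: "f \<in> borel_measurable (lebesgue_on {0..T})"
        using f by (intro continuous_imp_measurable_on_sets_lebesgue) auto
      have wm: "w \<in> borel_measurable (lebesgue_on {0..T})"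
        by (rule measurable_restrict_mono[OF meas]) auto
      have "continuous_on UNIV (\<lambda>x :: (real^'n^'m) \<times> (real^'n^'n). fst x ** snd x)"
        by (intro bounded_bilinear.continuous_on[OF bounded_bilinear_matrix_mult] continuous_intros)
      then show "(\<lambda>s. f s ** w s) \<in> borel_measurable (lebesgue_on {0..T})"
        by (rule borel_measurable_continuous_Pair[OF fm wm])
      show "(\<lambda>s. C * B * K) integrable_on {0..T}" by (rule integrable_const_ivl)
      fix s assume s: "s \<in> {0..T}"
      have "norm (f s) * norm (w s) \<le> C * B"
        using C B s by (intro mult_mono) (auto intro: less_imp_le)
      then show "norm (f s ** w s) \<le> C * B * K"
        using K[of "f s" "w s"] \<open>K > 0\<close> mult_right_mono[of _ _ K] by (meson order_trans less_imp_le)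
    qed auto
  qed
  define X where "X = (\<lambda>n. ((\<lambda>f t. integral {0..t} (\<lambda>s. f s ** w s)) ^^ n) (\<lambda>_. R0))"
  have X0: "X 0 t = R0" and XS: "X (Suc n) t = integral {0..t} (\<lambda>s. X n s ** w s)" for n t
    by (simp_all add: X_def)
  have Xc: "continuous_on {0..T} (X n)" for n T
  proof (induction n)
    case 0 show ?case by (simp add: X_def)
  next
    case (Suc n)
    show ?case unfolding XS[abs_def] by (rule indefinite_integral_continuous_1[OF int[OF Suc]])
  qed
  define S where "S = (\<lambda>n t. \<Sum>i<n. X i t)"
  define R where "R = (\<lambda>t. \<Sum>i. X i t)"
  have Sc: "continuous_on {0..T} (S n)" for n T
    unfolding S_def by (intro continuous_on_sum Xc)
  \<comment> \<open>The partial sums are the Picard iterates; the limit of this recursion is the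
    integral equation.\<close>
  have SS: "S (Suc n) t = R0 + integral {0..t} (\<lambda>s. S n s ** w s)" for n t
  proof -
    have "integral {0..t} (\<lambda>s. S n s ** w s) = (\<Sum>i<n. integral {0..t} (\<lambda>s. X i s ** w s))"
      unfolding S_def
      by (subst integral_sum[symmetric])
         (auto simp: int[OF Xc] bounded_bilinear.sum_left[OF bounded_bilinear_matrix_mult])
    then show ?thesis
      by (simp add: S_def sum.lessThan_Suc_shift X0 XS del: sum.lessThan_Suc)
  qed
  have main: "(\<forall>t\<in>{0..T}. R t = R0 + integral {0..t} (\<lambda>s. R s ** w s)) \<and> continuous_on {0..T} R"
    if "T \<ge> 0" for T
  proof -
    obtain B0 where B0: "\<forall>t\<in>{0..T}. norm (w t) \<le> B0" using bounded by blast
    define B where "B = max B0 1"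
    have B: "norm (w t) \<le> B" if "t \<in> {0..T}" for t
      using B0 that by (auto simp: B_def le_max_iff_disj)
    have "B > 0" by (simp add: B_def)
    define M where "M = (\<lambda>n. norm R0 * ((K * B * T) ^ n / fact n))"
    \<comment> \<open>Each integration raises the power in the previous bound and divides by the new
      exponent. The factorials give uniform convergence on [0, T] however large
      \<open>K * B * T\<close> is.\<close>
    have bd: "norm (X n t) \<le> norm R0 * ((K * B * t) ^ n / fact n)" if "t \<in> {0..T}" for n t
      using that
    proof (induction n arbitrary: t)
      case 0 then show ?case by (simp add: X0)
    next
      case (Suc n)
      let ?F = "\<lambda>s. norm R0 * ((K * B * s) ^ Suc n / fact (Suc n))"
      let ?f = "\<lambda>s. norm R0 * ((K * B * s) ^ n / fact n) * B * K"
      have der: "(?F has_vector_derivative ?f s) (at s within {0..t})" for s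
      proof -
        have "((\<lambda>s. K * B * s) has_real_derivative K * B) (at s within {0..t})"
          by (auto intro!: derivative_eq_intros)
        then have "(?F has_real_derivative norm R0 * ((1 + real n) * (K * B * (K * B * s) ^ n) / fact (Suc n)))
            (at s within {0..t})"
          by (intro DERIV_cmult DERIV_cdivide DERIV_power_Suc)
        moreover have "fact (Suc n) = (1 + real n) * fact n" "1 + real n \<noteq> 0" by simp_all
        then have "norm R0 * ((1 + real n) * (K * B * (K * B * s) ^ n) / fact (Suc n)) = ?f s"
          by (simp only: mult_divide_mult_cancel_left) simp
        ultimately show ?thesis
          by (metis (no_types) has_real_derivative_iff_has_vector_derivative)
      qed
      have fint: "(?f has_integral (?F t - ?F 0)) {0..t}"
        by (rule fundamental_theorem_of_calculus) (use Suc der in auto)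
      have "norm (X (Suc n) t) \<le> integral {0..t} ?f"
        unfolding XS
      proof (rule integral_norm_bound_integral[OF int[OF Xc]])
        show "?f integrable_on {0..t}" using fint by blast
        fix s assume s: "s \<in> {0..t}"
        then have s': "s \<in> {0..T}" using Suc.prems by auto
        have "norm (X n s ** w s) \<le> norm (X n s) * norm (w s) * K" by (rule K)
        also have "\<dots> \<le> norm R0 * ((K * B * s) ^ n / fact n) * B * K"
          using Suc.IH[OF s'] B[OF s'] \<open>B > 0\<close> \<open>K > 0\<close> s
          by (intro mult_right_mono mult_mono) auto
        finally show "norm (X n s ** w s) \<le> ?f s" .
      qed
      also have "\<dots> = ?F t - ?F 0" by (rule integral_unique[OF fint])
      also have "\<dots> = ?F t" by simp
      finally show ?case .
    qed
    have bdM: "norm (X n t) \<le> M n" if "t \<in> {0..T}" for n t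
      unfolding M_def
      by (rule order_trans[OF bd[OF that]])
         (use that \<open>B > 0\<close> \<open>K > 0\<close> in \<open>auto intro!: mult_left_mono divide_right_mono power_mono\<close>)
    have "summable M"
      unfolding M_def using summable_exp[of "K * B * T"] by (intro summable_mult) (simp add: field_simps)
    have unif: "uniform_limit {0..T} S R sequentially"
      unfolding S_def R_def by (rule Weierstrass_m_test[OF bdM \<open>summable M\<close>])
    have Rc: "continuous_on {0..T} R"
      by (rule uniform_limit_theorem[OF _ unif]) (auto simp: Sc)
    have lim: "(\<lambda>n. S n t) \<longlonglongrightarrow> R t" if "t \<in> {0..T}" for t
      using tendsto_uniform_limitI[OF unif that] .
    have M0: "M n \<ge> 0" for n using \<open>K > 0\<close> \<open>B > 0\<close> \<open>T \<ge> 0\<close> by (simp add: M_def)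
    have Sbd: "norm (S n t) \<le> suminf M" if "t \<in> {0..T}" for n t
    proof -
      have "norm (S n t) \<le> (\<Sum>i<n. M i)"
        unfolding S_def by (intro sum_norm_le bdM that)
      also have "\<dots> \<le> suminf M" using \<open>summable M\<close> M0 by (intro sum_le_suminf) auto
      finally show ?thesis .
    qed
    have "R t = R0 + integral {0..t} (\<lambda>s. R s ** w s)" if t: "t \<in> {0..T}" for t
    proof -
      have sub: "s \<in> {0..T}" if "s \<in> {0..t}" for s using that t by auto
      have "(\<lambda>n. integral {0..t} (\<lambda>s. S n s ** w s)) \<longlonglongrightarrow> integral {0..t} (\<lambda>s. R s ** w s)"
      proof (rule dominated_convergence(2))
        show "(\<lambda>s. S n s ** w s) integrable_on {0..t}" for n by (rule int[OF Sc])
        show "(\<lambda>s. suminf M * B * K) integrable_on {0..t}" by (rule integrable_const_ivl)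
        show "norm (S n s ** w s) \<le> suminf M * B * K" if "s \<in> {0..t}" for n s
        proof (rule order_trans[OF K])
          show "norm (S n s) * norm (w s) * K \<le> suminf M * B * K"
            using Sbd[OF sub[OF that]] B[OF sub[OF that]] \<open>K > 0\<close> suminf_nonneg[OF \<open>summable M\<close> M0]
            by (intro mult_right_mono mult_mono) auto
        qed
        show "(\<lambda>n. S n s ** w s) \<longlonglongrightarrow> R s ** w s" if "s \<in> {0..t}" for s
          by (intro bounded_bilinear.tendsto[OF bounded_bilinear_matrix_mult] lim sub that tendsto_const)
      qed
      then have "(\<lambda>n. S (Suc n) t) \<longlonglongrightarrow> R0 + integral {0..t} (\<lambda>s. R s ** w s)"
        unfolding SS by (intro tendsto_intros)
      moreover have "(\<lambda>n. S (Suc n) t) \<longlonglongrightarrow> R t" using lim[OF t] by (rule LIMSEQ_Suc)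
      ultimately show ?thesis using LIMSEQ_unique by blast
    qed
    with Rc show ?thesis by blast
  qed
  have Rint: "(\<lambda>s. R s ** w s) integrable_on {0..T}" for T
    by (cases "T \<ge> 0") (use int[OF conjunct2[OF main]] in \<open>auto intro: integrable_on_empty\<close>)
  have Req: "R t = R0 + integral {0..t} (\<lambda>s. R s ** w s)" if "t \<ge> 0" for t
    by (rule bspec[OF conjunct1[OF main[OF that]]]) (use that in auto)
  obtain N where N: "negligible N" "\<And>t. t \<in> {0..} - N \<Longrightarrow>
      ((\<lambda>t. integral {0..t} (\<lambda>s. R s ** w s)) has_vector_derivative R t ** w t) (at t within {0..})"
    using indefinite_integral_has_vector_derivative_AE[OF Rint] by blast
  show thesis
  proof (rule that[OF _ _ N(1)])
    show "R 0 = R0" using Req[of 0] by simp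
    show "(R has_vector_derivative R t ** w t) (at t within {0..})" if "t \<in> {0..} - N" for t
    proof (rule has_vector_derivative_transform[where f = "\<lambda>t. R0 + integral {0..t} (\<lambda>s. R s ** w s)"])
      show "((\<lambda>t. R0 + integral {0..t} (\<lambda>s. R s ** w s)) has_vector_derivative R t ** w t) (at t within {0..})"
        using N(2)[OF that] by (auto intro!: derivative_eq_intros)
    qed (use that in \<open>auto intro: Req\<close>)
    show "\<exists>L. L-lipschitz_on {0..T} R" for T
    proof (cases "T \<ge> 0")
      case True
      obtain B where B: "\<forall>t\<in>{0..T}. norm (w t) \<le> B" using bounded by blast
      then have "B \<ge> 0" using True by (metis atLeastAtMost_iff norm_ge_zero order_refl order_trans)
      have "bounded (R ` {0..T})" using conjunct2[OF main[OF True]] by (intro compact_imp_bounded compact_continuous_image) auto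
      then obtain C where C: "\<And>t. t \<in> {0..T} \<Longrightarrow> norm (R t) \<le> C" "C > 0"
        unfolding bounded_pos by (meson imageI)
      have le: "norm (R s ** w s) \<le> C * B * K" if "s \<in> {0..T}" for s
      proof (rule order_trans[OF K])
        show "norm (R s) * norm (w s) * K \<le> C * B * K"
          using C(1)[OF that] B that C(2) \<open>K > 0\<close> by (intro mult_right_mono mult_mono) auto
      qed
      have "norm (R y - R x) \<le> C * B * K * (y - x)" if "0 \<le> x" "x \<le> y" "y \<le> T" for x y
      proof -
        have "R y - R x = integral {x..y} (\<lambda>s. R s ** w s)"
          using Henstock_Kurzweil_Integration.integral_combine[OF that(1,2) Rint[of y]] Req[of x] Req[of y] that
          by (simp add: algebra_simps)
        moreover have "norm (integral {x..y} (\<lambda>s. R s ** w s)) \<le> integral {x..y} (\<lambda>_. C * B * K)"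
          using that le by (intro integral_norm_bound_integral integrable_on_subinterval[OF Rint[of T]]) auto
        ultimately show ?thesis using that by (simp add: algebra_simps)
      qed
      then have "(C * B * K)-lipschitz_on {0..T} R"
        using C(2) \<open>B \<ge> 0\<close> \<open>K > 0\<close>
        by (intro lipschitz_on_leI) (auto simp: dist_norm norm_minus_commute)
      then show ?thesis by blast
    qed (auto intro: exI[of _ 0] simp: lipschitz_on_def)
  qed
qed

section \<open>The Cayley transform\<close>

lemma matrix3_eqI:
  fixes A B :: "'a^3^3"
  assumes "A $ 1 $ 1 = B $ 1 $ 1" "A $ 1 $ 2 = B $ 1 $ 2" "A $ 1 $ 3 = B $ 1 $ 3"
    "A $ 2 $ 1 = B $ 2 $ 1" "A $ 2 $ 2 = B $ 2 $ 2" "A $ 2 $ 3 = B $ 2 $ 3"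
    "A $ 3 $ 1 = B $ 3 $ 1" "A $ 3 $ 2 = B $ 3 $ 2" "A $ 3 $ 3 = B $ 3 $ 3"
  shows "A = B"
  using assms by (simp add: vec_eq_iff forall_3)

lemma matrix3_components:
  fixes A B :: mat3
  shows "(A + B) $ i $ j = A $ i $ j + B $ i $ j" "(A - B) $ i $ j = A $ i $ j - B $ i $ j"
    "(- A) $ i $ j = - A $ i $ j" "(c *\<^sub>R A) $ i $ j = c * A $ i $ j"
    "transpose A $ i $ j = A $ j $ i" "mat 1 $ i $ j = (if i = j then 1 else (0::real))"
    "(A ** B) $ i $ j = A $ i $ 1 * B $ 1 $ j + A $ i $ 2 * B $ 2 $ j + A $ i $ 3 * B $ 3 $ j"
    "trace A = A $ 1 $ 1 + A $ 2 $ 2 + A $ 3 $ 3"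
  by (simp_all add: transpose_def mat_def matrix_matrix_mult_def sum_3 trace_def)

text \<open>The matrix of the map taking x to the cross product of \<open>u\<close> and x.\<close>

definition hat :: "real^3 \<Rightarrow> mat3" where
  "hat u = vector [vector [0, - u $ 3, u $ 2], vector [u $ 3, 0, - u $ 1], vector [- u $ 2, u $ 1, 0]]"

lemma hat_components [simp]:
  "hat u $ 1 $ 1 = 0" "hat u $ 1 $ 2 = - u $ 3" "hat u $ 1 $ 3 = u $ 2"
  "hat u $ 2 $ 1 = u $ 3" "hat u $ 2 $ 2 = 0" "hat u $ 2 $ 3 = - u $ 1"
  "hat u $ 3 $ 1 = - u $ 2" "hat u $ 3 $ 2 = u $ 1" "hat u $ 3 $ 3 = 0"
  by (simp_all add: hat_def)

lemma linear_hat: "linear hat"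
  by (rule linearI; rule matrix3_eqI) (simp_all add: algebra_simps)

lemma hat_scaleR: "hat (c *\<^sub>R u) = c *\<^sub>R hat u"
  by (simp add: linear_scale[OF linear_hat])

lemma inner_3: "u \<bullet> v = u $ 1 * v $ 1 + u $ 2 * v $ 2 + u $ 3 * (v :: real^3) $ 3"
  by (simp add: inner_vec_def sum_3)

text \<open>The Cayley-Hamilton theorem for \<open>hat u\<close>, whose characteristic polynomial is
  X^3 + |u|^2 X. It reduces every polynomial in \<open>hat u\<close> to the span of the identity,
  \<open>hat u\<close> and its square.\<close>

lemma hat_cube: "hat u ** hat u ** hat u = - (u \<bullet> u) *\<^sub>R hat u"
  by (rule matrix3_eqI) (simp_all add: matrix3_components inner_3 algebra_simps)

text \<open>This is (I + hat u) (I - hat u)^(-1) with the inverse multiplied out by means of the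
  cubic identity; equivalently, Rodrigues' formula for the rotation about \<open>u\<close> whose
  half angle has tangent \<open>norm u\<close>. Without an inverse it can be differentiated and
  expanded directly.\<close>

definition cayley :: "real^3 \<Rightarrow> mat3" where
  "cayley u = mat 1 + (2 / (1 + u \<bullet> u)) *\<^sub>R (hat u + hat u ** hat u)"

lemma one_plus_inner_pos: "0 < 1 + u \<bullet> (u :: real^3)"
  by (simp add: add_pos_nonneg)

lemma cayley_0 [simp]: "cayley 0 = mat 1"
  by (simp add: cayley_def linear_0[OF linear_hat])

lemma cayley_components:
  fixes u :: "real^3"
  defines "k \<equiv> 2 / (1 + u \<bullet> u)"
  shows "cayley u $ 1 $ 1 = 1 - k * (u$2*u$2 + u$3*u$3)" "cayley u $ 1 $ 2 = k * (u$1*u$2 - u$3)"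
    "cayley u $ 1 $ 3 = k * (u$1*u$3 + u$2)" "cayley u $ 2 $ 1 = k * (u$1*u$2 + u$3)"
    "cayley u $ 2 $ 2 = 1 - k * (u$1*u$1 + u$3*u$3)" "cayley u $ 2 $ 3 = k * (u$2*u$3 - u$1)"
    "cayley u $ 3 $ 1 = k * (u$1*u$3 - u$2)" "cayley u $ 3 $ 2 = k * (u$2*u$3 + u$1)"
    "cayley u $ 3 $ 3 = 1 - k * (u$1*u$1 + u$2*u$2)"
  unfolding cayley_def k_def[symmetric]
  by (simp_all add: matrix3_components algebra_simps)

lemma cayley_factor: "2 / (1 + u \<bullet> u) * (1 + u$1*u$1 + u$2*u$2 + u$3*(u::real^3)$3) = 2"
proof -
  have eq: "1 + u$1*u$1 + u$2*u$2 + u$3*u$3 = 1 + u \<bullet> u" by (simp add: inner_3)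
  show ?thesis unfolding eq using one_plus_inner_pos[of u] by (simp add: field_simps)
qed

lemma cayley_SO3: "cayley u \<in> SO3"
proof -
  define k where "k = 2 / (1 + u \<bullet> u)"
  have k: "k * (1 + u$1*u$1 + u$2*u$2 + u$3*u$3) = 2"
    unfolding k_def by (rule cayley_factor)
  note C = cayley_components[of u, folded k_def]
  define s where "s = u$1*u$1 + u$2*u$2 + u$3*u$3"
  \<comment> \<open>The defects of orthogonality and of the determinant are both multiples of this
    one quantity, so they can be expanded with \<open>k\<close> treated as an independent
    variable.\<close>
  have k0: "k * (k * (1 + s) - 2) = 0" using k by (simp add: s_def algebra_simps)
  have "cayley u ** transpose (cayley u) = mat 1 - (k * (k * (1 + s) - 2)) *\<^sub>R (hat u ** hat u)"
    by (rule matrix3_eqI; simp add: matrix3_components C s_def; simp add: algebra_simps)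
  moreover have "det (cayley u) = 1 + s * (k * (k * (1 + s) - 2))"
    unfolding det_3 C s_def by (simp add: algebra_simps)
  ultimately show ?thesis by (simp add: SO3_def k0)
qed

text \<open>With rotation angle \<theta> the trace is 1 + 2 cos \<theta>, so this is 4 cos^2
  (\<theta>/2). Its positivity is the nonsingularity of every Cayley transform.\<close>

lemma trace_cayley: "1 + trace (cayley u) = 4 / (1 + u \<bullet> u)"
proof -
  define k where "k = 2 / (1 + u \<bullet> u)"
  have k: "k * (1 + u$1*u$1 + u$2*u$2 + u$3*u$3) = 2"
    unfolding k_def by (rule cayley_factor)
  have "1 + trace (cayley u) = 2 * k"
    unfolding matrix3_components cayley_components[of u, folded k_def] using k by (simp add: algebra_simps)
  then show ?thesis by (simp add: k_def)
qed

lemma SO3_transpose_mult: "R \<in> SO3 \<Longrightarrow> transpose R ** R = mat 1"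
  unfolding SO3_def using matrix_left_right_inverse by blast

text \<open>For a 3 by 3 matrix, Cayley-Hamilton gives Q^2 as (trace Q) Q minus the trace of the
  adjugate plus the adjugate. A rotation equals its own cofactor matrix, so the adjugate becomes the
  transpose and its trace becomes \<open>trace Q\<close>.\<close>

lemma SO3_Cayley_Hamilton:
  assumes Q: "Q \<in> SO3"
  shows "Q ** Q = trace Q *\<^sub>R Q - trace Q *\<^sub>R mat 1 + transpose Q"
proof -
  \<comment> \<open>The cofactor matrix of \<open>Q\<close>; its transpose is the adjugate.\<close>
  define C :: mat3 where "C = vector [
    vector [Q$2$2 * Q$3$3 - Q$2$3 * Q$3$2, Q$2$3 * Q$3$1 - Q$2$1 * Q$3$3, Q$2$1 * Q$3$2 - Q$2$2 * Q$3$1],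
    vector [Q$1$3 * Q$3$2 - Q$1$2 * Q$3$3, Q$1$1 * Q$3$3 - Q$1$3 * Q$3$1, Q$1$2 * Q$3$1 - Q$1$1 * Q$3$2],
    vector [Q$1$2 * Q$2$3 - Q$1$3 * Q$2$2, Q$1$3 * Q$2$1 - Q$1$1 * Q$2$3, Q$1$1 * Q$2$2 - Q$1$2 * Q$2$1]]"
  have "Q ** transpose C = det Q *\<^sub>R mat 1"
    by (rule matrix3_eqI) (simp_all add: matrix3_components C_def det_3 algebra_simps)
  then have "Q ** transpose C = mat 1" using Q by (simp add: SO3_def)
  then have "transpose Q ** (Q ** transpose C) = transpose Q" by simp
  then have "transpose C = transpose Q"
    by (simp add: matrix_mul_assoc SO3_transpose_mult[OF Q])
  then have "C = Q" by (metis transpose_transpose)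
  have "Q ** Q = trace Q *\<^sub>R Q - trace C *\<^sub>R mat 1 + transpose C"
    by (rule matrix3_eqI) (simp_all add: matrix3_components C_def algebra_simps)
  then show ?thesis by (simp only: \<open>C = Q\<close>)
qed

definition vee :: "mat3 \<Rightarrow> real^3" where
  "vee Q = vector [Q$3$2 - Q$2$3, Q$1$3 - Q$3$1, Q$2$1 - Q$1$2]"

text \<open>For a rotation by \<theta> about the unit vector n, \<open>vee Q\<close> is 2 sin
  \<theta> n and the denominator is 2 + 2 cos \<theta>, so the quotient is tan (\<theta>/2) n. It is
  rational in the entries, hence differentiable where the trace is not -1.\<close>

definition cayley_inv :: "mat3 \<Rightarrow> real^3" where
  "cayley_inv Q = (1 / (1 + trace Q)) *\<^sub>R vee Q"

lemma cayley_inv_cayley: "cayley_inv (cayley u) = u"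
proof -
  define k where "k = 2 / (1 + u \<bullet> u)"
  have "k \<noteq> 0" using one_plus_inner_pos[of u] by (simp add: k_def)
  have "vee (cayley u) = (2 * k) *\<^sub>R u"
    unfolding vee_def cayley_components[of u, folded k_def]
    by (simp add: vec_eq_iff forall_3 algebra_simps)
  moreover have "1 + trace (cayley u) = 2 * k" by (simp add: trace_cayley k_def)
  ultimately show ?thesis using \<open>k \<noteq> 0\<close> by (simp add: cayley_inv_def)
qed

text \<open>With \<tau> = 1 + trace Q and hat v = Q - Q^T, Cayley-Hamilton expresses (hat v)^2
  through Q + Q^T. Taking traces gives |v|^2 = \<tau> (4 - \<tau>), which turns the denominator of
  \<open>cayley\<close> into 4 / \<tau>; what remains is linear in Q and Q^T.\<close>

lemma cayley_cayley_inv: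
  assumes Q: "Q \<in> SO3" and tr: "trace Q \<noteq> -1"
  shows "cayley (cayley_inv Q) = Q"
proof -
  define \<tau> where "\<tau> = 1 + trace Q"
  define v where "v = vee Q"
  have "\<tau> \<noteq> 0" using tr by (simp add: \<tau>_def)
  have ort: "transpose Q ** Q = mat 1" "Q ** transpose Q = mat 1"
    using Q SO3_transpose_mult by (auto simp: SO3_def)
  have v: "v $ 1 = Q$3$2 - Q$2$3" "v $ 2 = Q$1$3 - Q$3$1" "v $ 3 = Q$2$1 - Q$1$2"
    by (simp_all add: v_def vee_def)
  have V: "hat v = Q - transpose Q"
    by (rule matrix3_eqI) (simp_all add: matrix3_components v)
  have "hat v ** hat v = Q ** Q + transpose (Q ** Q) - 2 *\<^sub>R mat 1"
    unfolding V by (simp add: bounded_bilinear.diff_left[OF bounded_bilinear_matrix_mult]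
        bounded_bilinear.diff_right[OF bounded_bilinear_matrix_mult] ort matrix_transpose_mul scaleR_2)
  also have "\<dots> = \<tau> *\<^sub>R (Q + transpose Q) - (2 * \<tau>) *\<^sub>R mat 1"
    unfolding SO3_Cayley_Hamilton[OF Q] \<tau>_def
    by (rule matrix3_eqI; unfold matrix3_components; simp add: algebra_simps)
  finally have VV: "hat v ** hat v = \<tau> *\<^sub>R (Q + transpose Q) - (2 * \<tau>) *\<^sub>R mat 1" .
  have "trace (hat v ** hat v) = - 2 * (v \<bullet> v)"
    by (simp add: matrix3_components inner_3)
  moreover have "trace (hat v ** hat v) = 2 * \<tau> * (\<tau> - 4)"
    unfolding VV \<tau>_def by (simp add: matrix3_components algebra_simps)
  ultimately have vv: "v \<bullet> v = \<tau> * (4 - \<tau>)" by (simp add: algebra_simps)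
  have "cayley_inv Q = (1 / \<tau>) *\<^sub>R v" by (simp add: cayley_inv_def \<tau>_def v_def)
  moreover have "1 + ((1 / \<tau>) *\<^sub>R v) \<bullet> ((1 / \<tau>) *\<^sub>R v) = 4 / \<tau>"
    using \<open>\<tau> \<noteq> 0\<close> by (simp add: vv field_simps)
  ultimately have "cayley (cayley_inv Q) = mat 1 + (\<tau> / 2) *\<^sub>R ((1 / \<tau>) *\<^sub>R hat v + (1 / (\<tau> * \<tau>)) *\<^sub>R (hat v ** hat v))"
    unfolding cayley_def by (simp add: hat_scaleR bounded_bilinear.scaleR_left[OF bounded_bilinear_matrix_mult]
        bounded_bilinear.scaleR_right[OF bounded_bilinear_matrix_mult])
  also have "\<dots> = (1 / (2 * \<tau>)) *\<^sub>R (\<tau> *\<^sub>R (2 *\<^sub>R mat 1 + hat v) + hat v ** hat v)"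
    using \<open>\<tau> \<noteq> 0\<close> by (simp add: scaleR_add_right field_simps)
  also have "\<tau> *\<^sub>R (2 *\<^sub>R mat 1 + hat v) + hat v ** hat v = (2 * \<tau>) *\<^sub>R Q"
    unfolding VV unfolding V by (rule matrix3_eqI; unfold matrix3_components; simp add: algebra_simps)
  also have "(1 / (2 * \<tau>)) *\<^sub>R ((2 * \<tau>) *\<^sub>R Q) = Q" using \<open>\<tau> \<noteq> 0\<close> by simp
  finally show ?thesis .
qed

section \<open>Derivative of the Cayley transform and null sets\<close>

lemma SO3_mult: "A \<in> SO3 \<Longrightarrow> B \<in> SO3 \<Longrightarrow> A ** B \<in> SO3"
  by (simp add: SO3_def matrix_transpose_mul det_mul)
     (metis matrix_mul_assoc matrix_mul_rid)

lemma SO3_mult_transpose: "A \<in> SO3 \<Longrightarrow> A ** transpose A = mat 1"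
  by (simp add: SO3_def)

lemma SO3_transpose: "A \<in> SO3 \<Longrightarrow> transpose A \<in> SO3"
  using SO3_transpose_mult[of A] by (simp add: SO3_def det_transpose)

lemma bounded_linear_hat: "bounded_linear hat"
  using linear_hat by (simp add: linear_conv_bounded_linear)

definition dcayley :: "real^3 \<Rightarrow> real^3 \<Rightarrow> mat3" where
  "dcayley u h = (2 / (1 + u \<bullet> u)) *\<^sub>R (hat h + hat h ** hat u + hat u ** hat h)
     - (4 * (u \<bullet> h) / (1 + u \<bullet> u)\<^sup>2) *\<^sub>R (hat u + hat u ** hat u)"

lemma cayley_has_derivative: "(cayley has_derivative dcayley u) (at u within S)"
proof -
  have h: "(hat has_derivative hat) (at u within S)"
    by (rule bounded_linear_imp_has_derivative[OF bounded_linear_hat])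
  have hh: "((\<lambda>u. hat u + hat u ** hat u) has_derivative
      (\<lambda>h. hat h + (hat u ** hat h + hat h ** hat u))) (at u within S)"
    by (intro has_derivative_add h bounded_bilinear.FDERIV[OF bounded_bilinear_matrix_mult])
  have c: "((\<lambda>u. 2 / (1 + u \<bullet> u)) has_derivative (\<lambda>h. - (4 * (u \<bullet> h) / (1 + u \<bullet> u)\<^sup>2))) (at u within S)"
    using one_plus_inner_pos[of u]
    by (auto intro!: derivative_eq_intros simp: fun_eq_iff inner_commute power2_eq_square field_simps)
  have "((\<lambda>u. mat 1 + (2 / (1 + u \<bullet> u)) *\<^sub>R (hat u + hat u ** hat u)) has_derivative
      (\<lambda>h. 0 + ((2 / (1 + u \<bullet> u)) *\<^sub>R (hat h + (hat u ** hat h + hat h ** hat u))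
        + (- (4 * (u \<bullet> h) / (1 + u \<bullet> u)\<^sup>2)) *\<^sub>R (hat u + hat u ** hat u)))) (at u within S)"
    by (intro has_derivative_add has_derivative_const has_derivative_scaleR c hh)
  then show ?thesis
    unfolding cayley_def[abs_def] dcayley_def[abs_def] by (simp add: algebra_simps)
qed

lemma continuous_on_matrix_mult [continuous_intros]:
  fixes f :: "'a::topological_space \<Rightarrow> real^'n^'m" and g :: "'a \<Rightarrow> real^'p^'n"
  shows "continuous_on S f \<Longrightarrow> continuous_on S g \<Longrightarrow> continuous_on S (\<lambda>x. f x ** g x)"
  by (rule bounded_bilinear.continuous_on[OF bounded_bilinear_matrix_mult])

lemma continuous_on_hat [continuous_intros]:
  "continuous_on S f \<Longrightarrow> continuous_on S (\<lambda>x. hat (f x))"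
  by (rule bounded_linear.continuous_on[OF bounded_linear_hat])

lemma continuous_on_dcayley [continuous_intros]:
  "continuous_on S f \<Longrightarrow> continuous_on S (\<lambda>x. dcayley (f x) h)"
  unfolding dcayley_def using one_plus_inner_pos
  by (intro continuous_intros) (auto simp: less_imp_neq[symmetric])

lemma continuous_on_cayley [continuous_intros]:
  "continuous_on S f \<Longrightarrow> continuous_on S (\<lambda>x. cayley (f x))"
  unfolding cayley_def using one_plus_inner_pos
  by (intro continuous_intros) (auto simp: less_imp_neq[symmetric])

text \<open>The chain rule for the left inverse \<open>cayley_inv\<close> gives
  \<open>dcayley u\<close> a left inverse without any computation.\<close>

lemma inj_dcayley: "inj (dcayley u)"
proof -
  have v: "linear vee"
    by (rule linearI) (simp_all add: vee_def vec_eq_iff forall_3 algebra_simps)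
  have t: "linear (trace :: mat3 \<Rightarrow> real)"
    by (rule linearI) (simp_all add: trace_def sum.distrib sum_distrib_left)
  have "1 + trace (cayley u) \<noteq> 0"
    using one_plus_inner_pos[of u] by (simp add: trace_cayley)
  then have "cayley_inv differentiable at (cayley u)"
    unfolding cayley_inv_def[abs_def]
    by (intro derivative_intros linear_imp_differentiable[OF t] linear_imp_differentiable[OF v]) auto
  then obtain D where D: "(cayley_inv has_derivative D) (at (cayley u))"
    unfolding differentiable_def by blast
  have "(cayley_inv \<circ> cayley has_derivative D \<circ> dcayley u) (at u)"
    by (rule diff_chain_at[OF cayley_has_derivative D])
  moreover have "cayley_inv \<circ> cayley = (\<lambda>x. x)" by (auto simp: cayley_inv_cayley)
  ultimately have "((\<lambda>x. x) has_derivative D \<circ> dcayley u) (at u)" by simp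
  then have "D \<circ> dcayley u = (\<lambda>x. x)"
    using has_derivative_unique has_derivative_ident by blast
  then show ?thesis by (metis comp_apply injI)
qed

text \<open>Right translates of the Cayley chart, centred so that the origin goes to (A, B). They
  turn null sets of the state space into negligible sets of coordinates around any given
  state.\<close>

lemma local_parametrization_cayley:
  assumes A: "A \<in> SO3" and B: "B \<in> SO3"
  shows "local_parametrization UNIV (\<lambda>(u, v). (cayley u ** A, cayley v ** B))"
proof -
  have cancel: "X = Y" if "X ** R = Y ** R" "R \<in> SO3" for X Y R :: mat3
    using that by (metis SO3_mult_transpose matrix_mul_assoc matrix_mul_rid)
  define D where "D = (\<lambda>x h. (dcayley (fst x) (fst h) ** A, dcayley (snd x) (snd h) ** B))"
  have m: "((\<lambda>x. cayley (f x) ** C) has_derivative (\<lambda>h. dcayley (f x) (f h) ** C)) (at x)"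
    if "bounded_linear f" for f :: "(real^3) \<times> (real^3) \<Rightarrow> real^3" and C x
  proof -
    have "(f has_derivative f) (at x)" by (rule bounded_linear_imp_has_derivative[OF that])
    from diff_chain_at[OF this cayley_has_derivative]
    have "((\<lambda>x. cayley (f x)) has_derivative (\<lambda>h. dcayley (f x) (f h))) (at x)"
      by (simp add: o_def)
    then show ?thesis
      by (rule bounded_linear.has_derivative[OF bounded_bilinear.bounded_linear_left[OF bounded_bilinear_matrix_mult]])
  qed
  have der: "((\<lambda>(u, v). (cayley u ** A, cayley v ** B)) has_derivative D x) (at x)" for x
    unfolding D_def case_prod_unfold
    by (intro has_derivative_Pair m bounded_linear_fst bounded_linear_snd)
  have inj: "inj (D x)" for x
    unfolding D_def by (rule injI) (use A B inj_dcayley in \<open>auto simp: prod_eq_iff inj_def dest!: cancel\<close>)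
  have cont: "continuous_on UNIV (\<lambda>x. D x v)" for v
    unfolding D_def by (intro continuous_intros)
  have "inj cayley" by (metis cayley_inv_cayley injI)
  then have "inj (\<lambda>(u, v). (cayley u ** A, cayley v ** B))"
    using A B by (auto simp: inj_def dest!: cancel)
  moreover have "range (\<lambda>(u, v). (cayley u ** A, cayley v ** B)) \<subseteq> state_space"
    using A B by (auto simp: state_space_def SO3_mult cayley_SO3)
  ultimately show ?thesis
    unfolding local_parametrization_def using der inj cont by blast
qed

text \<open>The preimage of \<open>W\<close> in the chart centred at \<open>x\<close> is open and
  nonempty, hence not negligible, so \<open>S\<close> cannot contain the part of the state space in
  \<open>W\<close>. Arbitrary null sets in the Filippov map are handled through this
  density.\<close>

lemma null_in_state_space_dense_complement:
  assumes S: "null_in_state_space S" and x: "x \<in> state_space" and W: "open W" "x \<in> W"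
  obtains y where "y \<in> W" "y \<in> state_space - S"
proof -
  obtain A B where xAB: "x = (A, B)" "A \<in> SO3" "B \<in> SO3"
    using x by (auto simp: state_space_def)
  define \<phi> where "\<phi> = (\<lambda>(u, v). (cayley u ** A, cayley v ** B))"
  have lp: "local_parametrization UNIV \<phi>"
    unfolding \<phi>_def by (rule local_parametrization_cayley[OF xAB(2,3)])
  have neg: "negligible {u. \<phi> u \<in> S}"
    using S lp unfolding null_in_state_space_def by force
  have "continuous_on UNIV \<phi>"
    unfolding \<phi>_def case_prod_unfold by (intro continuous_intros)
  then have op: "open (\<phi> -` W)"
    using W(1) by (simp add: continuous_on_open_vimage)
  have "\<phi> 0 = x" by (simp add: \<phi>_def xAB case_prod_unfold)
  then have "\<phi> -` W \<noteq> {}" using W(2) by auto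
  then have "\<not> negligible (\<phi> -` W)" using op open_not_negligible by blast
  then have "\<not> \<phi> -` W \<subseteq> {u. \<phi> u \<in> S}" using neg negligible_subset by blast
  then obtain u where "\<phi> u \<in> W" "\<phi> u \<notin> S" by blast
  moreover have "\<phi> u \<in> state_space" using lp by (auto simp: local_parametrization_def)
  ultimately show thesis using that by blast
qed

section \<open>Cayley transforms along a ray\<close>

lemma hat_fourth: "hat u ** hat u ** (hat u ** hat u) = - (u \<bullet> u) *\<^sub>R (hat u ** hat u)"
proof -
  have "hat u ** hat u ** (hat u ** hat u) = (hat u ** hat u ** hat u) ** hat u"
    by (simp only: matrix_mul_assoc)
  then show ?thesis
    by (simp only: hat_cube bounded_bilinear.scaleR_left[OF bounded_bilinear_matrix_mult])
qed

lemmas matrix_bilinear_simps =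
  bounded_bilinear.scaleR_left[OF bounded_bilinear_matrix_mult]
  bounded_bilinear.scaleR_right[OF bounded_bilinear_matrix_mult]
  bounded_bilinear.add_left[OF bounded_bilinear_matrix_mult]
  bounded_bilinear.add_right[OF bounded_bilinear_matrix_mult]
  bounded_bilinear.diff_left[OF bounded_bilinear_matrix_mult]
  bounded_bilinear.diff_right[OF bounded_bilinear_matrix_mult]
  bounded_bilinear.minus_left[OF bounded_bilinear_matrix_mult]
  bounded_bilinear.minus_right[OF bounded_bilinear_matrix_mult]

lemma cayley_square:
  fixes u :: "real^3"
  defines "c \<equiv> 2 / (1 + u \<bullet> u)"
  shows "cayley u ** cayley u = mat 1 + (2 * (c * c - c)) *\<^sub>R hat u + (2 * (c * c)) *\<^sub>R (hat u ** hat u)"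
proof -
  define k where "k = u \<bullet> u"
  \<comment> \<open>This relation removes \<open>k\<close> from the coefficients and leaves
    polynomials in \<open>c\<close>.\<close>
  have ck: "c * k = 2 - c" using one_plus_inner_pos[of u] by (simp add: c_def k_def field_simps)
  have h3: "hat u ** (hat u ** hat u) = - k *\<^sub>R hat u" "hat u ** hat u ** hat u = - k *\<^sub>R hat u"
    by (simp_all only: matrix_mul_assoc hat_cube k_def)
  have "cayley u ** cayley u = mat 1 + (2 * c) *\<^sub>R (hat u + hat u ** hat u)
     + (c * c) *\<^sub>R (hat u ** hat u + (- 2 * k) *\<^sub>R hat u + (- k) *\<^sub>R (hat u ** hat u))"
    unfolding cayley_def unfolding c_def[symmetric] matrix_bilinear_simps h3 hat_fourth
    unfolding k_def[symmetric] by (simp add: vec_eq_iff algebra_simps)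
  also have "\<dots> = mat 1 + (2 * c - 2 * c * (c * k)) *\<^sub>R hat u + (2 * c + c * c - c * (c * k)) *\<^sub>R (hat u ** hat u)"
    by (simp add: vec_eq_iff algebra_simps)
  also have "\<dots> = mat 1 + (2 * (c * c - c)) *\<^sub>R hat u + (2 * (c * c)) *\<^sub>R (hat u ** hat u)"
    unfolding ck by (simp add: algebra_simps)
  finally show ?thesis .
qed

text \<open>The field I - Q^2 is therefore tangent to the rays: it is the derivative of
  \<open>cayley (s *\<^sub>R p)\<close> when s' = -2 s.\<close>

lemma dcayley_radial: "2 *\<^sub>R dcayley u u = cayley u ** cayley u - mat 1"
proof -
  define c where "c = 2 / (1 + u \<bullet> u)"
  define k where "k = u \<bullet> u"
  have ck: "c * k = 2 - c" using one_plus_inner_pos[of u] by (simp add: c_def k_def field_simps)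
  have "4 * (u \<bullet> u) / (1 + u \<bullet> u)\<^sup>2 = c * (c * k)" by (simp add: c_def k_def power2_eq_square)
  also have "\<dots> = c * (2 - c)" by (simp only: ck)
  finally have "2 *\<^sub>R dcayley u u = 2 *\<^sub>R (c *\<^sub>R (hat u + hat u ** hat u + hat u ** hat u) - (c * (2 - c)) *\<^sub>R (hat u + hat u ** hat u))"
    unfolding dcayley_def c_def[symmetric] by simp
  also have "\<dots> = (2 * (c * c - c)) *\<^sub>R hat u + (2 * (c * c)) *\<^sub>R (hat u ** hat u)"
    by (simp add: vec_eq_iff algebra_simps)
  finally show ?thesis by (simp add: cayley_square c_def)
qed

text \<open>Under the root stands 8 sin^2 (\<theta>/2), where \<theta> is the rotation angle. The
  formula supplies both the exponential bound for the first law and the gain of the second law on a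
  ray.\<close>

lemma norm_cayley_minus_one: "norm (cayley u - mat 1) = sqrt (8 * (u \<bullet> u) / (1 + u \<bullet> u))"
proof -
  define c where "c = 2 / (1 + u \<bullet> u)"
  define k where "k = u \<bullet> u"
  have ck: "c * (1 + k) = 2" using one_plus_inner_pos[of u] by (simp add: c_def k_def field_simps)
  have "(hat u + hat u ** hat u) \<bullet> (hat u + hat u ** hat u) = 2 * k * (1 + k)"
    by (simp add: inner_vec_def sum_3 matrix3_components k_def algebra_simps)
  then have "(cayley u - mat 1) \<bullet> (cayley u - mat 1) = c * (c * (2 * k * (1 + k)))"
    by (simp add: cayley_def c_def)
  also have "\<dots> = c * (1 + k) * c * 2 * k" by simp
  also have "\<dots> = 8 * k / (1 + k)" unfolding ck by (simp add: c_def k_def)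
  finally show ?thesis by (simp add: norm_eq_sqrt_inner k_def)
qed

section \<open>The closed-loop fields and the Filippov map\<close>

lemma bounded_linear_transpose: "bounded_linear (transpose :: mat3 \<Rightarrow> mat3)"
  by (auto simp: linear_conv_bounded_linear[symmetric] transpose_def vec_eq_iff intro!: linearI)

lemma inner_matrix_mult_right: "(A ** R) \<bullet> B = A \<bullet> (B ** transpose R)" for A B R :: mat3
  by (simp add: inner_vec_def sum_3 matrix3_components algebra_simps)

lemma inner_SO3_mult:
  fixes A B R :: mat3
  assumes "R \<in> SO3"
  shows "(A ** R) \<bullet> (B ** R) = A \<bullet> B"
  by (simp add: inner_matrix_mult_right SO3_mult_transpose[OF assms] flip: matrix_mul_assoc)

lemma norm_SO3_mult: "R \<in> SO3 \<Longrightarrow> norm (A ** R) = norm A" for A R :: mat3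
  by (simp add: norm_eq_sqrt_inner inner_SO3_mult)

lemma norm_SO3:
  assumes "R \<in> SO3"
  shows "norm R = sqrt 3"
proof -
  have "norm R = norm (mat 1 :: mat3)" using norm_SO3_mult[OF assms, of "mat 1"] by simp
  also have "\<dots> = sqrt 3" by (simp add: norm_eq_frobenius sum_3 mat_def)
  finally show ?thesis .
qed

lemma norm_SO3_le: "R \<in> SO3 \<Longrightarrow> norm R \<le> 2"
  by (simp add: norm_SO3 real_le_lsqrt)

text \<open>Right multiplication by a skew-symmetric matrix is skew for the Frobenius inner product.
  Two states driven by the same target velocity do not feel it in their distance, so no bound on
  \<open>w\<close> enters the one-sided Lipschitz constants.\<close>

lemma inner_mult_so3:
  fixes M w :: mat3
  assumes "w \<in> so3"
  shows "M \<bullet> (M ** w) = 0"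
proof -
  have "M \<bullet> (M ** w) = (M ** w) \<bullet> M" by (rule inner_commute)
  also have "\<dots> = M \<bullet> (M ** - w)"
    using assms by (simp add: inner_matrix_mult_right so3_def)
  also have "\<dots> = - (M \<bullet> (M ** w))" by (simp add: matrix_bilinear_simps)
  finally show ?thesis by simp
qed

text \<open>Substituting R1 = Rr + E separates a contracting linear part from a quadratic remainder;
  division by \<open>norm E\<close> will turn the linear part into a multiple of
  \<open>sgn E\<close>.\<close>

lemma feedback_eq:
  assumes "Rr \<in> SO3" "R1 \<in> SO3"
  shows "R1 ** (transpose R1 ** Rr - transpose Rr ** R1)
    = - 2 *\<^sub>R (R1 - Rr) - (R1 - Rr) ** (transpose Rr ** (R1 - Rr))"
proof -
  have "R1 ** (transpose R1 ** Rr) = Rr"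
    by (simp add: matrix_mul_assoc SO3_mult_transpose[OF assms(2)])
  moreover have "transpose Rr ** Rr = mat 1" "Rr ** (transpose Rr ** R1) = R1"
    by (simp_all add: matrix_mul_assoc SO3_mult_transpose[OF assms(1)] SO3_transpose_mult[OF assms(1)])
  ultimately show ?thesis
    by (simp add: matrix_bilinear_simps scaleR_2)
qed

lemma feedback_relative_eq:
  assumes "Rr \<in> SO3" "Q \<in> SO3"
  shows "Q ** Rr ** (transpose (Q ** Rr) ** Rr - transpose Rr ** (Q ** Rr)) = (mat 1 - Q ** Q) ** Rr"
proof -
  have "Q ** Rr ** (transpose (Q ** Rr) ** Rr) = Rr"
    by (simp add: matrix_mul_assoc SO3_mult_transpose[OF SO3_mult[OF assms(2,1)]])
  moreover have "Q ** Rr ** (transpose Rr ** (Q ** Rr)) = Q ** ((Rr ** transpose Rr) ** (Q ** Rr))"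
    by (simp only: matrix_mul_assoc)
  then have "Q ** Rr ** (transpose Rr ** (Q ** Rr)) = Q ** Q ** Rr"
    by (simp add: SO3_mult_transpose[OF assms(1)] matrix_mul_assoc)
  ultimately show ?thesis by (simp only: matrix_bilinear_simps matrix_mul_lid)
qed

definition field_a :: "mat3 \<Rightarrow> mat3 \<times> mat3 \<Rightarrow> mat3" where
  "field_a w y = snd y ** omega_a (fst y) (snd y) w"

definition field_f :: "mat3 \<Rightarrow> mat3 \<times> mat3 \<Rightarrow> mat3" where
  "field_f w y = snd y ** omega_f (fst y) (snd y) w"

lemma field_a_relative:
  assumes "Rr \<in> SO3" "Q \<in> SO3"
  shows "field_a w (Rr, Q ** Rr) = (mat 1 - Q ** Q) ** Rr + Q ** Rr ** w"
  unfolding field_a_def omega_a_def fst_conv snd_conv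
    bounded_bilinear.add_right[OF bounded_bilinear_matrix_mult] feedback_relative_eq[OF assms] ..

lemma field_f_relative:
  assumes "Rr \<in> SO3" "Q \<in> SO3"
  shows "field_f w (Rr, Q ** Rr) = (1 / norm (Q - mat 1)) *\<^sub>R ((mat 1 - Q ** Q) ** Rr) + Q ** Rr ** w"
proof -
  have "norm (Q ** Rr - Rr) = norm ((Q - mat 1) ** Rr)"
    by (simp add: matrix_bilinear_simps)
  then have "norm (Q ** Rr - Rr) = norm (Q - mat 1)"
    by (simp add: norm_SO3_mult[OF assms(1)])
  then show ?thesis
    unfolding field_f_def omega_f_def fst_conv snd_conv
      bounded_bilinear.add_right[OF bounded_bilinear_matrix_mult]
      bounded_bilinear.scaleR_right[OF bounded_bilinear_matrix_mult] feedback_relative_eq[OF assms]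
    by simp
qed

lemma field_a_eq:
  assumes "Rr \<in> SO3" "R1 \<in> SO3"
  shows "field_a w (Rr, R1) = - 2 *\<^sub>R (R1 - Rr) - (R1 - Rr) ** (transpose Rr ** (R1 - Rr)) + R1 ** w"
  unfolding field_a_def omega_a_def fst_conv snd_conv
    bounded_bilinear.add_right[OF bounded_bilinear_matrix_mult] feedback_eq[OF assms] ..

text \<open>The formula covers the diagonal too, where the conventions 1 / 0 = 0 and sgn 0 = 0 both
  leave \<open>R1 ** w\<close>.\<close>

lemma field_f_eq:
  assumes "Rr \<in> SO3" "R1 \<in> SO3"
  shows "field_f w (Rr, R1) = - 2 *\<^sub>R sgn (R1 - Rr) - (R1 - Rr) ** (transpose Rr ** sgn (R1 - Rr)) + R1 ** w"
  unfolding field_f_def omega_f_def fst_conv snd_conv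
    bounded_bilinear.add_right[OF bounded_bilinear_matrix_mult]
    bounded_bilinear.scaleR_right[OF bounded_bilinear_matrix_mult] feedback_eq[OF assms]
  by (simp add: sgn_div_norm scaleR_diff_right matrix_bilinear_simps divide_inverse mult.commute)

text \<open>\<open>sgn z\<close> is a subgradient of the norm at z, and subgradients of a convex
  function are monotone. Concretely, z . sgn v <= norm z, with equality for v = z.\<close>

lemma sgn_monotone: "0 \<le> (x - y) \<bullet> (sgn x - sgn y)" for x y :: "'a::real_inner"
proof -
  have eq: "z \<bullet> sgn z = norm z" for z :: 'a
    by (cases "z = 0") (simp_all add: sgn_div_norm dot_square_norm power2_eq_square)
  have le: "z \<bullet> sgn v \<le> norm z" for z v :: 'a
  proof -
    have "z \<bullet> sgn v \<le> norm z * norm (sgn v)" by (rule norm_cauchy_schwarz)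
    also have "\<dots> \<le> norm z" by (simp add: norm_sgn)
    finally show ?thesis .
  qed
  show ?thesis using eq[of x] eq[of y] le[of x y] le[of y x] by (simp add: inner_diff_left inner_diff_right)
qed

text \<open>\<open>sgn\<close> is not Lipschitz near 0, but the factor \<open>norm y\<close> absorbs
  the blow-up of order 1 / norm y. The quadratic remainder of the feedback carries just such a
  factor.\<close>

lemma norm_mult_sgn_diff_le: "norm y * norm (sgn x - sgn y) \<le> 2 * norm (x - y)" for x y :: "'a::real_inner"
proof (cases "x = 0")
  case True
  then show ?thesis by (cases "y = 0") (auto simp: norm_sgn)
next
  case False
  have "norm y * norm (sgn x - sgn y) = norm (norm y *\<^sub>R (sgn x - sgn y))" by simp
  also have "norm y *\<^sub>R (sgn x - sgn y) = (norm y - norm x) *\<^sub>R sgn x + (x - y)"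
    using False by (cases "y = 0") (simp_all add: sgn_div_norm algebra_simps)
  also have "norm \<dots> \<le> norm ((norm y - norm x) *\<^sub>R sgn x) + norm (x - y)"
    by (rule norm_triangle_ineq)
  also have "norm ((norm y - norm x) *\<^sub>R sgn x) \<le> norm (x - y)"
    using False norm_triangle_ineq3[of y x] by (simp add: norm_sgn norm_minus_commute)
  finally show ?thesis by simp
qed

lemma norm_mult_transpose_SO3_le:
  obtains C where "C > 0" "\<And>Rr x y. Rr \<in> SO3 \<Longrightarrow> norm (x ** (transpose Rr ** y)) \<le> C * norm (x :: mat3) * norm (y :: mat3)"
    "\<And>x y. norm (x ** y) \<le> C * norm (x :: mat3) * norm (y :: mat3)"
proof -
  obtain K :: real where "K > 0"
    and K: "\<And>x y. norm (x ** (y::mat3)) \<le> norm (x::mat3) * norm y * K"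
    using bounded_bilinear.pos_bounded[OF bounded_bilinear_matrix_mult] by blast
  show thesis
  \<comment> \<open>The first summand pays for two products with a rotation of norm at most 2 in
    between, the second for a single product.\<close>
  proof (rule that[of "K * 2 * K + K"])
    show "K * 2 * K + K > 0" using \<open>K > 0\<close> by (simp add: add_pos_pos)
    fix x y :: mat3
    have nn: "0 \<le> K * 2 * K * norm x * norm y" "0 \<le> K * norm x * norm y" using \<open>K > 0\<close> by simp_all
    show "norm (x ** y) \<le> (K * 2 * K + K) * norm x * norm y"
      using K[of x y] nn by (simp add: algebra_simps)
    fix Rr :: mat3 assume "Rr \<in> SO3"
    have "norm (transpose Rr ** y) \<le> norm (transpose Rr) * norm y * K" by (rule K)
    also have "\<dots> \<le> 2 * norm y * K"
      using norm_SO3_le[OF SO3_transpose[OF \<open>Rr \<in> SO3\<close>]] \<open>K > 0\<close> by (intro mult_right_mono) auto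
    finally have "norm x * norm (transpose Rr ** y) * K \<le> norm x * (2 * norm y * K) * K"
      using \<open>K > 0\<close> by (intro mult_right_mono mult_left_mono) auto
    then show "norm (x ** (transpose Rr ** y)) \<le> (K * 2 * K + K) * norm x * norm y"
      using K[of x "transpose Rr ** y"] nn by (simp add: algebra_simps)
  qed
qed

lemma field_one_sided_Lipschitz:
  obtains L where "\<And>Rr R1 S1 w. \<lbrakk>Rr \<in> SO3; R1 \<in> SO3; S1 \<in> SO3; w \<in> so3\<rbrakk> \<Longrightarrow>
      (R1 - S1) \<bullet> (field_a w (Rr, R1) - field_a w (Rr, S1)) \<le> L * (norm (R1 - S1))\<^sup>2"
    "\<And>Rr R1 S1 w. \<lbrakk>Rr \<in> SO3; R1 \<in> SO3; S1 \<in> SO3; w \<in> so3\<rbrakk> \<Longrightarrow>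
      (R1 - S1) \<bullet> (field_f w (Rr, R1) - field_f w (Rr, S1)) \<le> L * (norm (R1 - S1))\<^sup>2"
proof -
  obtain C where "C > 0" and C: "\<And>Rr x y. Rr \<in> SO3 \<Longrightarrow> norm (x ** (transpose Rr ** y)) \<le> C * norm (x :: mat3) * norm (y :: mat3)"
    using norm_mult_transpose_SO3_le by metis
  have cs: "- (m \<bullet> b) \<le> c * (norm m)\<^sup>2" if "norm b \<le> c * norm m" for m b :: mat3 and c
  proof -
    have "- (m \<bullet> b) \<le> norm m * norm b" using norm_cauchy_schwarz[of "- m" b] by simp
    also have "\<dots> \<le> norm m * (c * norm m)" using that by (rule mult_left_mono) simp
    finally show ?thesis by (simp add: power2_eq_square algebra_simps)
  qed
  show thesis
  \<comment> \<open>Errors have norm at most 4, so the remainder of the first law contributes 4 C +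
    4 C; that of the second contributes C + 2 C, which fits under the same constant.\<close>
  proof (rule that[of "8 * C"])
    fix Rr R1 S1 w assume R: "Rr \<in> SO3" "R1 \<in> SO3" "S1 \<in> SO3" and w: "w \<in> so3"
    define E where "E = R1 - Rr"
    define F where "F = S1 - Rr"
    have EF: "R1 - S1 = E - F" by (simp add: E_def F_def)
    have bd: "norm E \<le> 4" "norm F \<le> 4"
      unfolding E_def F_def using norm_triangle_ineq4[of R1 Rr] norm_triangle_ineq4[of S1 Rr] R[THEN norm_SO3_le] by linarith+
    have z: "(R1 - S1) \<bullet> (R1 ** w) - (R1 - S1) \<bullet> (S1 ** w) = 0"
      using inner_mult_so3[OF w, of "R1 - S1"] by (simp add: matrix_bilinear_simps inner_diff_right)
    let ?b = "\<lambda>x y. x ** (transpose Rr ** y)"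
    have "norm (?b E E - ?b F F) = norm (?b (E - F) E + ?b F (E - F))"
      by (simp add: matrix_bilinear_simps)
    also have "\<dots> \<le> C * norm (E - F) * norm E + C * norm F * norm (E - F)"
      by (rule order_trans[OF norm_triangle_ineq]) (intro add_mono C R)
    also have "\<dots> \<le> C * norm (E - F) * 4 + C * 4 * norm (E - F)"
      using bd \<open>C > 0\<close> by (intro add_mono mult_right_mono mult_left_mono) auto
    finally have "- ((E - F) \<bullet> (?b E E - ?b F F)) \<le> 8 * C * (norm (E - F))\<^sup>2"
      by (intro cs) simp
    moreover have "(R1 - S1) \<bullet> (field_a w (Rr, R1) - field_a w (Rr, S1))
        = - 2 * ((E - F) \<bullet> (E - F)) - (E - F) \<bullet> (?b E E - ?b F F)"
      using z unfolding field_a_eq[OF R(1,2)] field_a_eq[OF R(1,3)] EF E_def[symmetric] F_def[symmetric]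
      by (simp add: inner_diff_right inner_add_right algebra_simps)
    ultimately show "(R1 - S1) \<bullet> (field_a w (Rr, R1) - field_a w (Rr, S1)) \<le> 8 * C * (norm (R1 - S1))\<^sup>2"
      unfolding EF using inner_ge_zero[of "E - F"] by linarith
    have "norm (?b E (sgn E) - ?b F (sgn F)) = norm (?b (E - F) (sgn E) + ?b F (sgn E - sgn F))"
      by (simp add: matrix_bilinear_simps)
    also have "\<dots> \<le> C * norm (E - F) * norm (sgn E) + C * norm F * norm (sgn E - sgn F)"
      by (rule order_trans[OF norm_triangle_ineq]) (intro add_mono C R)
    also have "\<dots> \<le> C * norm (E - F) * 1 + C * (2 * norm (E - F))"
      unfolding mult.assoc[of C "norm F"]
      using norm_mult_sgn_diff_le[of F E] \<open>C > 0\<close> by (intro add_mono mult_left_mono) (auto simp: norm_sgn)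
    also have "\<dots> \<le> 8 * C * norm (E - F)" using \<open>C > 0\<close> by (simp add: algebra_simps)
    finally have "- ((E - F) \<bullet> (?b E (sgn E) - ?b F (sgn F))) \<le> 8 * C * (norm (E - F))\<^sup>2"
      by (rule cs)
    moreover have "(R1 - S1) \<bullet> (field_f w (Rr, R1) - field_f w (Rr, S1))
        = - 2 * ((E - F) \<bullet> (sgn E - sgn F)) - (E - F) \<bullet> (?b E (sgn E) - ?b F (sgn F))"
      using z unfolding field_f_eq[OF R(1,2)] field_f_eq[OF R(1,3)] EF E_def[symmetric] F_def[symmetric]
      by (simp add: inner_diff_right inner_add_right algebra_simps)
    ultimately show "(R1 - S1) \<bullet> (field_f w (Rr, R1) - field_f w (Rr, S1)) \<le> 8 * C * (norm (R1 - S1))\<^sup>2"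
      unfolding EF using sgn_monotone[of E F] by linarith
  qed
qed

section \<open>One-sided bounds on the Filippov map and members of it\<close>

lemma filippov_field_f:
  "filippov (\<lambda>(Pr, P1) t. P1 ** omega_f Pr P1 (w t)) x t =
     (\<Inter>\<delta>\<in>{0<..}. \<Inter>S\<in>Collect null_in_state_space.
        closure (convex hull (field_f (w t) ` (ball x \<delta> \<inter> state_space - S))))"
  by (simp add: filippov_def field_f_def[abs_def] case_prod_unfold)

text \<open>On a small ball the values of the field lie in the half-space of level h x + e. Being
  closed and convex, it contains their closed convex hull; then e tends to 0.\<close>

lemma filippov_inner_le:
  assumes V: "V \<in> filippov (\<lambda>(Pr, P1) t. P1 ** omega_f Pr P1 (w t)) x t"
    and h: "isCont h x" and le: "\<And>y. y \<in> state_space \<Longrightarrow> a \<bullet> field_f (w t) y \<le> h y"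
  shows "a \<bullet> V \<le> h x"
proof (rule field_le_epsilon)
  fix e :: real assume "0 < e"
  obtain d where "d > 0" and d: "\<And>y. dist y x < d \<Longrightarrow> dist (h y) (h x) < e"
    using h \<open>0 < e\<close> unfolding continuous_at_eps_delta by (metis dist_norm)
  \<comment> \<open>An upper bound on the intersection can be read off from the member from which
    nothing is removed.\<close>
  have "null_in_state_space {}" by (simp add: null_in_state_space_def)
  then have "V \<in> closure (convex hull (field_f (w t) ` (ball x d \<inter> state_space - {})))"
    using V \<open>d > 0\<close> unfolding filippov_field_f by (auto simp del: Diff_empty)
  also have "\<dots> \<subseteq> {W. a \<bullet> W \<le> h x + e}"
  proof (rule closure_minimal[OF hull_minimal])
    show "field_f (w t) ` (ball x d \<inter> state_space - {}) \<subseteq> {W. a \<bullet> W \<le> h x + e}"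
    proof clarsimp
      fix p q assume y: "dist x (p, q) < d" "(p, q) \<in> state_space"
      then have "dist (h (p, q)) (h x) < e" using d[of "(p, q)"] by (metis dist_commute)
      then show "a \<bullet> field_f (w t) (p, q) \<le> h x + e"
        using le[OF y(2)] by (auto simp: dist_real_def abs_if split: if_splits)
    qed
    show "convex {W. a \<bullet> W \<le> h x + e}" by (rule convex_halfspace_le)
    show "closed {W. a \<bullet> W \<le> h x + e}" by (rule closed_halfspace_le)
  qed
  finally show "a \<bullet> V \<le> h x + e" by simp
qed

text \<open>Nearby states have different references, so each state \<open>y\<close> is compared with
  its own \<open>Q ** fst y\<close> for a fixed relative rotation \<open>Q\<close>. The comparison
  velocity is then continuous in the state, even for Q = mat 1, where the comparison runs along the
  diagonal.\<close>

lemma filippov_one_sided_Lipschitz: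
  obtains L where "\<And>Rr R1 Q w t V. \<lbrakk>Rr \<in> SO3; R1 \<in> SO3; Q \<in> SO3; w t \<in> so3;
      V \<in> filippov (\<lambda>(Pr, P1) t. P1 ** omega_f Pr P1 (w t)) (Rr, R1) t\<rbrakk> \<Longrightarrow>
      (R1 - Q ** Rr) \<bullet> (V - field_f (w t) (Rr, Q ** Rr)) \<le> L * (norm (R1 - Q ** Rr))\<^sup>2"
proof -
  obtain L where L: "\<And>Rr R1 S1 w. \<lbrakk>Rr \<in> SO3; R1 \<in> SO3; S1 \<in> SO3; w \<in> so3\<rbrakk> \<Longrightarrow>
      (R1 - S1) \<bullet> (field_f w (Rr, R1) - field_f w (Rr, S1)) \<le> L * (norm (R1 - S1))\<^sup>2"
    using field_one_sided_Lipschitz by metis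
  obtain C where "C > 0" and C: "\<And>Rr x y. Rr \<in> SO3 \<Longrightarrow> norm (x ** (transpose Rr ** y)) \<le> C * norm (x :: mat3) * norm (y :: mat3)"
      "\<And>x y. norm (x ** y) \<le> C * norm (x :: mat3) * norm (y :: mat3)"
    using norm_mult_transpose_SO3_le by metis
  \<comment> \<open>The direction \<open>a\<close> stays fixed while the state varies in the ball;
    boundedness of the field controls the error made by this.\<close>
  have bound: "norm (field_f w y) \<le> 2 + C * 4 + C * 2 * norm w" if y: "y \<in> state_space" for w y
  proof -
    obtain Rr R1 where R: "y = (Rr, R1)" "Rr \<in> SO3" "R1 \<in> SO3" using y by (auto simp: state_space_def)
    define E where "E = R1 - Rr"
    have E: "norm E \<le> 4"
      unfolding E_def using norm_triangle_ineq4[of R1 Rr] R(2,3)[THEN norm_SO3_le] by linarith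
    have s: "norm (sgn E) \<le> 1" by (simp add: norm_sgn)
    have "norm (E ** (transpose Rr ** sgn E)) \<le> C * norm E * norm (sgn E)" by (rule C(1)[OF R(2)])
    also have "\<dots> \<le> C * 4 * 1" using E s \<open>C > 0\<close> by (intro mult_mono) auto
    finally have 1: "norm (E ** (transpose Rr ** sgn E)) \<le> C * 4" by simp
    have "norm (R1 ** w) \<le> C * norm R1 * norm w" by (rule C(2))
    also have "\<dots> \<le> C * 2 * norm w"
      using norm_SO3_le[OF R(3)] \<open>C > 0\<close> by (intro mult_mono mult_left_mono) auto
    finally have 2: "norm (R1 ** w) \<le> C * 2 * norm w" .
    have "norm (field_f w y) \<le> norm (- 2 *\<^sub>R sgn E - E ** (transpose Rr ** sgn E)) + norm (R1 ** w)"
      unfolding R(1) field_f_eq[OF R(2,3)] E_def[symmetric] by (rule norm_triangle_ineq)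
    also have "\<dots> \<le> norm (- 2 *\<^sub>R sgn E) + norm (E ** (transpose Rr ** sgn E)) + norm (R1 ** w)"
      by (intro add_right_mono norm_triangle_ineq4)
    finally show ?thesis using 1 2 s by simp
  qed
  show thesis
  proof (rule that[of L])
    fix Rr R1 Q w t V
    assume R: "Rr \<in> SO3" "R1 \<in> SO3" and Q: "Q \<in> SO3" and w: "w t \<in> so3"
      and V: "V \<in> filippov (\<lambda>(Pr, P1) t. P1 ** omega_f Pr P1 (w t)) (Rr, R1) t"
    define B where "B = 2 + C * 4 + C * 2 * norm (w t)"
    define m where "m = (\<lambda>y :: mat3 \<times> mat3. snd y - Q ** fst y)"
    \<comment> \<open>On states (Rr, Q Rr) the gain depends on \<open>Q\<close> alone, so
      \<open>X\<close> is linear in \<open>fst y\<close>. For Q = mat 1 the first term vanishes, in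
      agreement with the default value of \<open>omega_f\<close> on the diagonal.\<close>
    define X where "X = (\<lambda>y :: mat3 \<times> mat3.
      (1 / norm (Q - mat 1)) *\<^sub>R ((mat 1 - Q ** Q) ** fst y) + Q ** fst y ** w t)"
    define a where "a = m (Rr, R1)"
    \<comment> \<open>The last summand accounts for testing with \<open>a\<close> instead of
      \<open>m y\<close>. It vanishes at the centre, where \<open>h\<close> takes exactly the value
      claimed.\<close>
    define h where "h = (\<lambda>y. m y \<bullet> X y + L * (norm (m y))\<^sup>2 + norm (a - m y) * B)"
    have X: "field_f (w t) (fst y, Q ** fst y) = X y" if "y \<in> state_space" for y
      using that field_f_relative[OF _ Q, of "fst y" "w t"] by (auto simp: X_def state_space_def)
    have "continuous_on UNIV h"
      unfolding h_def m_def X_def by (intro continuous_intros)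
    then have "isCont h (Rr, R1)" by (simp add: continuous_on_eq_continuous_at)
    moreover have "a \<bullet> field_f (w t) y \<le> h y" if y: "y \<in> state_space" for y
    proof -
      have ys: "fst y \<in> SO3" "snd y \<in> SO3" using y by (auto simp: state_space_def)
      have "(a - m y) \<bullet> field_f (w t) y \<le> norm (a - m y) * norm (field_f (w t) y)"
        by (rule norm_cauchy_schwarz)
      also have "\<dots> \<le> norm (a - m y) * B"
        unfolding B_def by (intro mult_left_mono bound y) simp
      finally have 1: "(a - m y) \<bullet> field_f (w t) y \<le> norm (a - m y) * B" .
      have "m y \<bullet> (field_f (w t) y - X y) \<le> L * (norm (m y))\<^sup>2"
        using L[OF ys SO3_mult[OF Q ys(1)] w] unfolding X[OF y] m_def by simp
      with 1 show ?thesis by (simp add: h_def inner_diff_left inner_diff_right)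
    qed
    ultimately have "a \<bullet> V \<le> h (Rr, R1)" by (rule filippov_inner_le[OF V])
    moreover have "(Rr, R1) \<in> state_space" using R by (simp add: state_space_def)
    ultimately show "(R1 - Q ** Rr) \<bullet> (V - field_f (w t) (Rr, Q ** Rr)) \<le> L * (norm (R1 - Q ** Rr))\<^sup>2"
      using X[of "(Rr, R1)"] by (simp add: h_def a_def m_def inner_diff_right)
  qed
qed

text \<open>Off the diagonal the field is continuous and the complement of \<open>S\<close> is
  dense, so removing \<open>S\<close> is invisible after closure. The point \<open>y\<close> may
  differ from the centre \<open>x\<close>; the diagonal case approaches its centre through such
  points.\<close>

lemma field_f_in_closure_image:
  assumes S: "null_in_state_space S" and y: "y \<in> ball x d \<inter> state_space" "fst y \<noteq> snd y"
  shows "field_f w y \<in> closure (field_f w ` (ball x d \<inter> state_space - S))"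
  unfolding closure_approachable
proof (intro allI impI)
  fix e :: real assume "0 < e"
  have "isCont (field_f w) y"
    unfolding field_f_def[abs_def] omega_f_def
    using y(2)
    by (intro bounded_bilinear.continuous[OF bounded_bilinear_matrix_mult] continuous_intros
        bounded_linear.continuous[OF bounded_linear_transpose]) auto
  then obtain r where "r > 0" and r: "\<And>z. dist z y < r \<Longrightarrow> dist (field_f w z) (field_f w y) < e"
    using \<open>0 < e\<close> unfolding continuous_at_eps_delta by (metis dist_norm)
  obtain z where "z \<in> ball y r \<inter> ball x d" "z \<in> state_space - S"
    by (rule null_in_state_space_dense_complement[OF S, of y "ball y r \<inter> ball x d"])
       (use y \<open>r > 0\<close> in auto)
  then have "dist z y < r" "z \<in> ball x d \<inter> state_space - S" by (auto simp: dist_commute)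
  then show "\<exists>v\<in>field_f w ` (ball x d \<inter> state_space - S). dist v (field_f w y) < e"
    using r by blast
qed

lemma field_f_in_filippov:
  assumes "(Rr, R1) \<in> state_space" "Rr \<noteq> R1"
  shows "field_f (w t) (Rr, R1) \<in> filippov (\<lambda>(Pr, P1) t. P1 ** omega_f Pr P1 (w t)) (Rr, R1) t"
  unfolding filippov_field_f
proof (clarsimp)
  fix d :: real and S assume "0 < d" "null_in_state_space S"
  then have "field_f (w t) (Rr, R1) \<in> closure (field_f (w t) ` (ball (Rr, R1) d \<inter> state_space - S))"
    using assms by (intro field_f_in_closure_image) auto
  then show "field_f (w t) (Rr, R1) \<in> closure (convex hull (field_f (w t) ` (ball (Rr, R1) d \<inter> state_space - S)))"
    using closure_mono[OF hull_subset] by blast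
qed


text \<open>On the diagonal the limit value arises as the midpoint of the velocities at two states whose
  errors are opposite.\<close>

lemma diagonal_velocity_in_filippov:
  assumes R: "Rr \<in> SO3"
  shows "Rr ** w t \<in> filippov (\<lambda>(Pr, P1) t. P1 ** omega_f Pr P1 (w t)) (Rr, Rr) t"
  unfolding filippov_field_f
proof (clarsimp)
  fix d :: real and S assume "0 < d" and S: "null_in_state_space S"
  define C where "C = closure (convex hull (field_f (w t) ` (ball (Rr, Rr) d \<inter> state_space - S)))"
  \<comment> \<open>One fixed unit axis; the two states with opposite errors, to first order, are
    \<open>y s\<close> and \<open>y (- s)\<close>.\<close>
  define p :: "real^3" where "p = axis 1 1"
  have pp: "p \<bullet> p = 1" by (simp add: p_def inner_axis_axis)
  define G where "G = hat p ** hat p"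
  define y where "y = (\<lambda>s. (Rr, cayley (s *\<^sub>R p) ** Rr))"
  \<comment> \<open>The midpoint of the two velocities once the terms odd in s have cancelled. The
    surviving feedback term is of order s, so \<open>N\<close> is continuous at 0.\<close>
  define N where "N = (\<lambda>s. (- 2 * (2 / (1 + s * s))\<^sup>2 * s / sqrt (8 / (1 + s * s))) *\<^sub>R (G ** Rr)
     + (1 / 2) *\<^sub>R ((cayley (s *\<^sub>R p) + cayley ((- s) *\<^sub>R p)) ** Rr ** w t))"
  have yss: "y s \<in> state_space" for s
    using R by (simp add: y_def state_space_def SO3_mult cayley_SO3)
  have r: "norm (cayley (s *\<^sub>R p) - mat 1) = \<bar>s\<bar> * sqrt (8 / (1 + s * s))" for s
    using norm_cayley_minus_one[of "s *\<^sub>R p"] pp real_sqrt_mult[of "s * s" "8 / (1 + s * s)"]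
    by (simp add: mult.commute)
  have pos: "1 + s * s > 0" for s :: real by (simp add: add_pos_nonneg)
  have inC: "field_f (w t) (y s) \<in> C" if "s \<noteq> 0" "y s \<in> ball (Rr, Rr) d" for s
  proof -
    have "norm (cayley (s *\<^sub>R p) ** Rr - Rr) = norm ((cayley (s *\<^sub>R p) - mat 1) ** Rr)"
      by (simp add: matrix_bilinear_simps)
    also have "\<dots> = \<bar>s\<bar> * sqrt (8 / (1 + s * s))" by (simp add: norm_SO3_mult[OF R] r)
    also have "\<dots> \<noteq> 0" using that(1) pos[of s] by simp
    finally have "fst (y s) \<noteq> snd (y s)" by (auto simp: y_def)
    then have "field_f (w t) (y s) \<in> closure (field_f (w t) ` (ball (Rr, Rr) d \<inter> state_space - S))"
      using that yss by (intro field_f_in_closure_image[OF S]) auto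
    then show ?thesis
      unfolding C_def using closure_mono[OF hull_subset] by blast
  qed
  have y0: "y 0 = (Rr, Rr)" by (simp add: y_def)
  have yt: "((\<lambda>s. y (c * s)) \<longlongrightarrow> (Rr, Rr)) (at 0)" for c
  proof -
    have "continuous_on UNIV (\<lambda>s. y (c * s))" unfolding y_def by (intro continuous_intros)
    then have "isCont (\<lambda>s. y (c * s)) 0" by (simp add: continuous_on_eq_continuous_at)
    then show ?thesis by (simp add: isCont_def y0)
  qed
  have ev: "\<forall>\<^sub>F s in at_right 0. N s \<in> C"
  proof -
    have 1: "\<forall>\<^sub>F s in at 0. y (c * s) \<in> ball (Rr, Rr) d" for c
      using yt[of c] \<open>0 < d\<close> by (intro topological_tendstoD) auto
    from 1[of 1] 1[of "-1"] have "\<forall>\<^sub>F s in at_right 0. y s \<in> ball (Rr, Rr) d \<and> y (- s) \<in> ball (Rr, Rr) d \<and> s > 0"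
      by (intro eventually_conj eventually_at_right_less) (auto simp: eventually_at_split)
    then show ?thesis
    proof eventually_elim
      case (elim s)
      define c where "c = 2 / (1 + s * s)"
      define k where "k = 1 / (s * sqrt (8 / (1 + s * s)))"
      have "convex C" unfolding C_def by (intro convex_closure convex_convex_hull)
      then have mid: "(1 / 2) *\<^sub>R field_f (w t) (y s) + (1 / 2) *\<^sub>R field_f (w t) (y (- s)) \<in> C"
        using elim by (intro convexD inC) auto
      \<comment> \<open>The coefficient of \<open>hat p ** Rr\<close> changes sign with s', that of
        \<open>G ** Rr\<close> does not. The former has a nonzero limit as s tends to 0, but drops
        out of the midpoint.\<close>
      have f: "field_f (w t) (y s') = k *\<^sub>R
          ((- (2 * (c * c - c) * s')) *\<^sub>R (hat p ** Rr) - (2 * (c * c) * (s * s)) *\<^sub>R (G ** Rr))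
          + cayley (s' *\<^sub>R p) ** Rr ** w t" if "s' = s \<or> s' = - s" for s'
        unfolding y_def field_f_relative[OF R cayley_SO3] r cayley_square
        using that elim pp by (auto simp: k_def c_def hat_scaleR matrix_bilinear_simps G_def)
      have "(1 / 2) *\<^sub>R field_f (w t) (y s) + (1 / 2) *\<^sub>R field_f (w t) (y (- s))
         = (k * (- (2 * (c * c) * (s * s)))) *\<^sub>R (G ** Rr)
           + (1 / 2) *\<^sub>R ((cayley (s *\<^sub>R p) + cayley ((- s) *\<^sub>R p)) ** Rr ** w t)"
        unfolding f[OF disjI1[OF refl]] f[OF disjI2[OF refl]]
        by (simp add: vec_eq_iff matrix_bilinear_simps algebra_simps)
      also have "\<dots> = N s"
        using elim by (simp add: N_def c_def k_def power2_eq_square)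
      finally show "N s \<in> C" using mid by simp
    qed
  qed
  have "continuous_on UNIV N"
    unfolding N_def using pos by (intro continuous_intros) (auto simp: less_imp_neq[symmetric])
  then have "isCont N 0" by (simp add: continuous_on_eq_continuous_at)
  then have "(N \<longlongrightarrow> N 0) (at 0)" by (simp add: isCont_def)
  then have "(N \<longlongrightarrow> N 0) (at_right 0)" by (rule filterlim_mono) (auto simp: at_le)
  moreover have "N 0 = Rr ** w t"
    by (simp add: N_def matrix_bilinear_simps flip: scaleR_2)
  moreover have "closed C" by (simp add: C_def)
  ultimately show "Rr ** w t \<in> closure (convex hull (field_f (w t) ` (ball (Rr, Rr) d \<inter> state_space - S)))"
    using Lim_in_closed_set[OF _ ev] unfolding C_def by force
qed

section \<open>Uniqueness and the reference curve\<close>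

text \<open>The squared distance g satisfies g' <= 2 L g almost everywhere and starts at 0, so the
  Gronwall estimate applies. The velocities are chosen anew at each time, which admits arbitrary
  Filippov selections.\<close>

lemma absolutely_continuous_curves_agree:
  fixes f g :: "real \<Rightarrow> 'a::real_inner"
  assumes J: "solution_domain J" and f: "absolutely_continuous_curve J f" and g: "absolutely_continuous_curve J g"
    and N: "negligible N"
    and der: "\<And>t. t \<in> J - N \<Longrightarrow> \<exists>v w. (f has_vector_derivative v) (at t within J) \<and>
      (g has_vector_derivative w) (at t within J) \<and> (f t - g t) \<bullet> (v - w) \<le> L * (norm (f t - g t))\<^sup>2"
    and "f 0 = g 0" "b \<in> J"
  shows "f b = g b"
proof -
  have "0 \<le> b" and sub: "{0..b} \<subseteq> J"
    using J \<open>b \<in> J\<close> by (auto simp: solution_domain_def is_interval_1)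
  then have ac: "absolutely_continuous_on_Icc 0 b (\<lambda>t. f t - g t)"
    using f g unfolding absolutely_continuous_curve_def by (blast intro: absolutely_continuous_on_Icc_diff)
  have "(f b - g b) \<bullet> (f b - g b) \<le> 0"
  proof (rule absolutely_continuous_on_Icc_gronwall[OF \<open>0 \<le> b\<close> _ N])
    show "absolutely_continuous_on_Icc 0 b (\<lambda>t. (f t - g t) \<bullet> (f t - g t))"
      by (rule bounded_bilinear.absolutely_continuous_on_Icc[OF bounded_bilinear_inner ac ac])
    fix t assume t: "t \<in> {0..b} - N"
    then obtain v w where v: "(f has_vector_derivative v) (at t within J)"
      and w: "(g has_vector_derivative w) (at t within J)"
      and le: "(f t - g t) \<bullet> (v - w) \<le> L * (norm (f t - g t))\<^sup>2"
      using der[of t] sub by blast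
    have "((\<lambda>t. f t - g t) has_vector_derivative v - w) (at t within {0..b})"
      by (intro has_vector_derivative_diff has_vector_derivative_within_subset[OF v sub]
          has_vector_derivative_within_subset[OF w sub])
    from bounded_bilinear.has_vector_derivative[OF bounded_bilinear_inner this this]
    have "((\<lambda>t. (f t - g t) \<bullet> (f t - g t)) has_real_derivative 2 * ((f t - g t) \<bullet> (v - w))) (at t within {0..b})"
      by (simp add: has_real_derivative_iff_has_vector_derivative inner_commute)
    moreover have "2 * ((f t - g t) \<bullet> (v - w)) \<le> (2 * L) * ((f t - g t) \<bullet> (f t - g t))"
      using le by (simp add: power2_norm_eq_inner)
    ultimately show "\<exists>d\<le>(2 * L) * ((f t - g t) \<bullet> (f t - g t)).
        ((\<lambda>t. (f t - g t) \<bullet> (f t - g t)) has_real_derivative d) (at t within {0..b})"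
      by blast
  qed (simp add: \<open>f 0 = g 0\<close>)
  then have "f b - g b = 0" by (metis inner_ge_zero inner_eq_zero_iff order_antisym)
  then show ?thesis by simp
qed

section \<open>Existence of the reference curve\<close>

lemma target_velocity_representative:
  assumes "target_velocity \<omega>"
  obtains w N where "w \<in> borel_measurable (lebesgue_on {0..})" "\<And>T. \<exists>B. \<forall>t\<in>{0..T}. norm (w t) \<le> B"
    "negligible N" "\<And>t. t \<notin> N \<Longrightarrow> w t = \<omega> t"
proof -
  have "\<exists>B N. negligible N \<and> (\<forall>t\<in>{0..real n} - N. norm (\<omega> t) \<le> B)" for n :: nat
  proof -
    obtain B where "AE t in lebesgue_on {0..real n}. norm (\<omega> t) \<le> B"
      using assms unfolding target_velocity_def by (metis of_nat_0_le_iff)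
    then show ?thesis by (subst (asm) AE_lebesgue_on_iff_negligible) auto
  qed
  then obtain B N where N: "\<And>n. negligible (N n)"
      and B: "\<And>n t. t \<in> {0..real n} - N n \<Longrightarrow> norm (\<omega> t) \<le> B n"
    by metis
  \<comment> \<open>One exceptional set for each interval [0, n], countably many in all. Setting the
    velocity to 0 on their union makes it bounded at every point of a bounded interval and changes
    the equation only on a null set.\<close>
  define M where "M = (\<Union>n. N n)"
  have M: "negligible M" unfolding M_def by (rule negligible_countable_Union) (use N in auto)
  define w where "w = (\<lambda>t. if t \<in> M then 0 else \<omega> t)"
  show thesis
  proof (rule that[OF _ _ M])
    have "M \<inter> {0..} \<in> sets (lebesgue_on {0..})"
      using negligible_imp_sets[OF M] by (auto simp: sets_restrict_space)
    moreover have "\<omega> \<in> borel_measurable (lebesgue_on {0..})"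
      using assms by (simp add: target_velocity_def)
    ultimately show "w \<in> borel_measurable (lebesgue_on {0..})"
      unfolding w_def by (intro measurable_If_set) auto
    show "\<exists>B. \<forall>t\<in>{0..T}. norm (w t) \<le> B" for T
    proof (intro exI ballI)
      fix t assume t: "t \<in> {0..T}"
      then have "t \<le> real (nat \<lceil>T\<rceil>)" by (meson atLeastAtMost_iff order_trans real_nat_ceiling_ge)
      then show "norm (w t) \<le> max 0 (B (nat \<lceil>T\<rceil>))"
        using B[of t "nat \<lceil>T\<rceil>"] t by (auto simp: w_def M_def le_max_iff_disj)
    qed
  qed (simp add: w_def)
qed

text \<open>The equation is solved in the space of all matrices. Then R R^T has derivative R
  (\<omega>^T + \<omega>) R^T = 0 almost everywhere, hence is constant; and the determinant,
  continuous with square 1, cannot jump from 1 to -1.\<close>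

lemma reference_exists:
  assumes \<omega>: "target_velocity \<omega>" and R0: "R0 \<in> SO3"
  obtains R N where "R 0 = R0" "\<And>t. 0 \<le> t \<Longrightarrow> R t \<in> SO3" "\<And>T. \<exists>L. L-lipschitz_on {0..T} R" "negligible N"
    "\<And>t. t \<in> {0..} - N \<Longrightarrow> (R has_vector_derivative R t ** \<omega> t) (at t within {0..})"
proof -
  obtain w N1 where w: "w \<in> borel_measurable (lebesgue_on {0..})" "\<And>T. \<exists>B. \<forall>t\<in>{0..T}. norm (w t) \<le> B"
    and N1: "negligible N1" "\<And>t. t \<notin> N1 \<Longrightarrow> w t = \<omega> t"
    using target_velocity_representative[OF \<omega>] by blast
  obtain R N2 where R: "R 0 = R0" "\<And>T. \<exists>L. L-lipschitz_on {0..T} R" and N2: "negligible N2"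
    "\<And>t. t \<in> {0..} - N2 \<Longrightarrow> (R has_vector_derivative R t ** w t) (at t within {0..})"
    using linear_ode_exists[OF w, of R0] by blast
  define N where "N = N1 \<union> N2"
  have N: "negligible N" using N1(1) N2(1) by (simp add: N_def)
  have der: "(R has_vector_derivative R t ** \<omega> t) (at t within {0..})" if "t \<in> {0..} - N" for t
    using N2(2)[of t] N1(2)[of t] that by (auto simp: N_def)
  have ac: "absolutely_continuous_on_Icc 0 T R" for T
    using R(2) lipschitz_on_imp_absolutely_continuous_on_Icc by blast
  have SO3: "R T \<in> SO3" if T: "0 \<le> T" for T
  proof -
    have ort: "R t ** transpose (R t) = mat 1" if "0 \<le> t" for t
    proof -
      have act: "absolutely_continuous_on_Icc 0 t (\<lambda>t. R t ** transpose (R t))"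
      proof (intro bounded_bilinear.absolutely_continuous_on_Icc[OF bounded_bilinear_matrix_mult] ac)
        obtain L where L: "L-lipschitz_on {0..t} R" using R(2) by blast
        obtain K where K: "K-lipschitz_on UNIV (transpose :: mat3 \<Rightarrow> mat3)"
          using bounded_linear_transpose bounded_linear.lipschitz_boundE by metis
        show "absolutely_continuous_on_Icc 0 t (\<lambda>t. transpose (R t))"
          by (rule lipschitz_on_imp_absolutely_continuous_on_Icc
              [OF lipschitz_on_compose2[OF L lipschitz_on_subset[OF K]]]) simp
      qed
      have "R t ** transpose (R t) = R 0 ** transpose (R 0)"
      proof (rule absolutely_continuous_on_Icc_constant[OF \<open>0 \<le> t\<close> act N])
        fix r assume r: "r \<in> {0..t} - N"
        then have "\<omega> r \<in> so3" using \<omega> by (simp add: target_velocity_def)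
        have d: "(R has_vector_derivative R r ** \<omega> r) (at r within {0..t})"
          by (rule has_vector_derivative_within_subset[OF der]) (use r in auto)
        have "((\<lambda>t. R t ** transpose (R t)) has_vector_derivative
            R r ** transpose (R r ** \<omega> r) + R r ** \<omega> r ** transpose (R r)) (at r within {0..t})"
          by (intro bounded_bilinear.has_vector_derivative[OF bounded_bilinear_matrix_mult] d
              bounded_linear.has_vector_derivative[OF bounded_linear_transpose])
        also have "R r ** transpose (R r ** \<omega> r) + R r ** \<omega> r ** transpose (R r) = 0"
          using \<open>\<omega> r \<in> so3\<close> by (simp add: so3_def matrix_transpose_mul matrix_mul_assoc matrix_bilinear_simps)
        finally show "((\<lambda>t. R t ** transpose (R t)) has_vector_derivative 0) (at r within {0..t})" .
      qed
      then show ?thesis using R0 R(1) by (simp add: SO3_def)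
    qed
    have det_sq: "det (R t) * det (R t) = 1" if "0 \<le> t" for t
      using arg_cong[OF ort[OF that], of det] by (simp add: det_mul det_transpose)
    have cont: "continuous_on {0..T} (\<lambda>t. det (R t))"
      unfolding det_3 using absolutely_continuous_on_Icc_imp_continuous_on[OF ac]
      by (intro continuous_intros) auto
    have "det (R T) = 1"
    proof (rule ccontr)
      assume "det (R T) \<noteq> 1"
      then have "det (R T) = -1" using det_sq[OF T] by (simp add: square_eq_1_iff)
      moreover have "det (R 0) = 1" using R0 R(1) by (simp add: SO3_def)
      ultimately obtain t where "0 \<le> t" "det (R t) = 0"
        using IVT2'[of "\<lambda>t. det (R t)" T 0 0] T cont by auto
      then show False using det_sq[of t] by simp
    qed
    then show ?thesis using ort[OF T] by (simp add: SO3_def)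
  qed
  show thesis by (rule that[OF R(1) SO3 R(2) N der])
qed

text \<open>One computation for both laws: \<open>g\<close> is the scalar gain in front of I - Q^2,
  equal to 1 for the first law and to 1 / norm (Q - mat 1) for the second.\<close>

lemma relative_curve_derivative:
  assumes R: "(Rr has_vector_derivative Rr t ** w) (at t within J)"
    and s: "(s has_real_derivative - 2 * s t * g) (at t within J)"
  shows "((\<lambda>t. cayley (s t *\<^sub>R p) ** Rr t) has_vector_derivative
      g *\<^sub>R ((mat 1 - cayley (s t *\<^sub>R p) ** cayley (s t *\<^sub>R p)) ** Rr t) + cayley (s t *\<^sub>R p) ** Rr t ** w)
      (at t within J)"
proof -
  interpret D: bounded_linear "dcayley (s t *\<^sub>R p)"
    using cayley_has_derivative has_derivative_bounded_linear by blast
  have "((\<lambda>t. s t *\<^sub>R p) has_vector_derivative (- 2 * s t * g) *\<^sub>R p) (at t within J)"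
    by (rule bounded_linear.has_vector_derivative[OF bounded_linear_scaleR_left])
       (use s in \<open>simp add: has_real_derivative_iff_has_vector_derivative\<close>)
  then have "((\<lambda>t. cayley (s t *\<^sub>R p)) has_vector_derivative
      dcayley (s t *\<^sub>R p) ((- 2 * s t * g) *\<^sub>R p)) (at t within J)"
    using vector_derivative_diff_chain_within[of "\<lambda>t. s t *\<^sub>R p" _ t J cayley] cayley_has_derivative
    by (force simp: o_def)
  also have "(- 2 * s t * g) *\<^sub>R p = (- g) *\<^sub>R (2 *\<^sub>R (s t *\<^sub>R p))" by simp
  also have "dcayley (s t *\<^sub>R p) ((- g) *\<^sub>R (2 *\<^sub>R (s t *\<^sub>R p)))
      = (- g) *\<^sub>R (2 *\<^sub>R dcayley (s t *\<^sub>R p) (s t *\<^sub>R p))"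
    by (simp only: D.scaleR)
  also have "\<dots> = g *\<^sub>R (mat 1 - cayley (s t *\<^sub>R p) ** cayley (s t *\<^sub>R p))"
    unfolding dcayley_radial by (simp add: algebra_simps)
  finally have "((\<lambda>t. cayley (s t *\<^sub>R p)) has_vector_derivative
      g *\<^sub>R (mat 1 - cayley (s t *\<^sub>R p) ** cayley (s t *\<^sub>R p))) (at t within J)" .
  from bounded_bilinear.has_vector_derivative[OF bounded_bilinear_matrix_mult this R]
  show ?thesis by (simp add: matrix_bilinear_simps matrix_mul_assoc add.commute)
qed

lemma relative_curve_state_curve:
  assumes R: "\<And>t. 0 \<le> t \<Longrightarrow> Rr t \<in> SO3" "\<And>T. \<exists>L. L-lipschitz_on {0..T} Rr"
    and s: "\<And>T. \<exists>L. L-lipschitz_on {0..T} s"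
  shows "state_curve {0..} Rr (\<lambda>t. cayley (s t *\<^sub>R p) ** Rr t)"
proof -
  have acR: "absolutely_continuous_on_Icc 0 T Rr" for T
    using R(2) lipschitz_on_imp_absolutely_continuous_on_Icc by blast
  have ac1: "absolutely_continuous_on_Icc 0 T (\<lambda>t. cayley (s t *\<^sub>R p) ** Rr t)" for T
  proof (intro bounded_bilinear.absolutely_continuous_on_Icc[OF bounded_bilinear_matrix_mult] acR)
    obtain L where L: "L-lipschitz_on {0..T} s" using s by blast
    have "bounded (s ` {0..T})"
      by (intro compact_imp_bounded compact_continuous_image lipschitz_on_continuous_on[OF L] compact_Icc)
    then obtain b where b: "\<And>t. t \<in> {0..T} \<Longrightarrow> \<bar>s t\<bar> \<le> b"
      unfolding bounded_iff real_norm_def by (meson imageI)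
    \<comment> \<open>Along the ray \<open>cayley\<close> is continuously differentiable, hence
      Lipschitz on the bounded range of \<open>s\<close>, and the composition is again
      Lipschitz.\<close>
    obtain K where K: "K-lipschitz_on {-b..b} (\<lambda>r. cayley (r *\<^sub>R p))"
    proof -
      have "((\<lambda>r. cayley (r *\<^sub>R p)) has_vector_derivative dcayley (r *\<^sub>R p) p) (at r within {-b..b})" for r
      proof -
        have "((\<lambda>r. r *\<^sub>R p) has_vector_derivative p) (at r within {-b..b})"
          by (auto intro!: derivative_eq_intros)
        from vector_derivative_diff_chain_within[OF this cayley_has_derivative]
        show ?thesis by (simp add: o_def)
      qed
      moreover have "continuous_on {-b..b} (\<lambda>r. dcayley (r *\<^sub>R p) p)"
        by (intro continuous_intros)
      ultimately have "\<exists>K. K-lipschitz_on {-b..b} (\<lambda>r. cayley (r *\<^sub>R p))"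
        by (rule C1_imp_lipschitz_on)
      then show thesis using that by blast
    qed
    have "s ` {0..T} \<subseteq> {-b..b}" using b by (force simp: abs_le_iff)
    from lipschitz_on_compose2[OF L lipschitz_on_subset[OF K this]]
    show "absolutely_continuous_on_Icc 0 T (\<lambda>t. cayley (s t *\<^sub>R p))"
      by (rule lipschitz_on_imp_absolutely_continuous_on_Icc)
  qed
  have "absolutely_continuous_on_Icc a b Rr"
    "absolutely_continuous_on_Icc a b (\<lambda>t. cayley (s t *\<^sub>R p) ** Rr t)" if "0 \<le> a" for a b
    using that by (blast intro: absolutely_continuous_on_Icc_subset[OF acR] absolutely_continuous_on_Icc_subset[OF ac1])+
  then show ?thesis
    unfolding state_curve_def absolutely_continuous_curve_def
    using R(1)
    by (auto simp: solution_domain_def is_interval_ci state_space_def SO3_mult cayley_SO3)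
qed

section \<open>Forward uniqueness of solutions\<close>

lemma solution_domain_sets_lebesgue: "solution_domain J \<Longrightarrow> J \<in> sets lebesgue"
  by (simp add: solution_domain_def real_interval_borel_measurable)

lemma AE_Ici_if_negligible:
  assumes "negligible N" "\<And>t. t \<in> {0..} - N \<Longrightarrow> P t"
  shows "AE t in lebesgue_on {0 :: real..}. P t"
  by (subst AE_lebesgue_on_iff_negligible) (use assms in auto)

lemma solution_a_D:
  assumes "solution_a \<omega> J Rr R1"
  shows "state_curve J Rr R1"
    and "\<exists>N. negligible N \<and> (\<forall>t\<in>J - N. (Rr has_vector_derivative Rr t ** \<omega> t) (at t within J) \<and>
      (R1 has_vector_derivative field_a (\<omega> t) (Rr t, R1 t)) (at t within J))"
proof -
  show c: "state_curve J Rr R1" using assms by (simp add: solution_a_def)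
  then have J: "J \<in> sets lebesgue" by (simp add: state_curve_def solution_domain_sets_lebesgue)
  show "\<exists>N. negligible N \<and> (\<forall>t\<in>J - N. (Rr has_vector_derivative Rr t ** \<omega> t) (at t within J) \<and>
      (R1 has_vector_derivative field_a (\<omega> t) (Rr t, R1 t)) (at t within J))"
    using conjunct2[OF assms[unfolded solution_a_def]]
    unfolding AE_lebesgue_on_iff_negligible[OF J] field_a_def fst_conv snd_conv .
qed

lemma solution_f_D:
  assumes "solution_f \<omega> J Rr R1"
  shows "state_curve J Rr R1"
    and "\<exists>N. negligible N \<and> (\<forall>t\<in>J - N. (Rr has_vector_derivative Rr t ** \<omega> t) (at t within J) \<and>
      (\<exists>V \<in> filippov (\<lambda>(Pr, P1) t. P1 ** omega_f Pr P1 (\<omega> t)) (Rr t, R1 t) t.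
           (R1 has_vector_derivative V) (at t within J)))"
proof -
  show c: "state_curve J Rr R1" using assms by (simp add: solution_f_def)
  then have J: "J \<in> sets lebesgue" by (simp add: state_curve_def solution_domain_sets_lebesgue)
  show "\<exists>N. negligible N \<and> (\<forall>t\<in>J - N. (Rr has_vector_derivative Rr t ** \<omega> t) (at t within J) \<and>
      (\<exists>V \<in> filippov (\<lambda>(Pr, P1) t. P1 ** omega_f Pr P1 (\<omega> t)) (Rr t, R1 t) t.
           (R1 has_vector_derivative V) (at t within J)))"
    using conjunct2[OF assms[unfolded solution_f_def]]
    unfolding AE_lebesgue_on_iff_negligible[OF J] .
qed

lemma state_curve_subset:
  assumes "state_curve K Rr R1" "solution_domain J" "J \<subseteq> K"
  shows "state_curve J Rr R1"
  using assms unfolding state_curve_def absolutely_continuous_curve_def by blast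

text \<open>The difference of two reference curves is orthogonal to its own velocity wherever both
  derivatives are given, so the constant L = 0 serves.\<close>

lemma reference_unique:
  assumes \<omega>: "target_velocity \<omega>" and c: "state_curve J Rr R1" "state_curve J Sr S1" and N: "negligible N"
    and der: "\<And>t. t \<in> J - N \<Longrightarrow> (Rr has_vector_derivative Rr t ** \<omega> t) (at t within J)"
      "\<And>t. t \<in> J - N \<Longrightarrow> (Sr has_vector_derivative Sr t ** \<omega> t) (at t within J)"
    and "Rr 0 = Sr 0" "b \<in> J"
  shows "Rr b = Sr b"
proof (rule absolutely_continuous_curves_agree[where N = N and L = 0])
  fix t assume t: "t \<in> J - N"
  then have "\<omega> t \<in> so3"
    using \<omega> c(1) by (auto simp: target_velocity_def state_curve_def solution_domain_def)
  then have "(Rr t - Sr t) \<bullet> (Rr t ** \<omega> t - Sr t ** \<omega> t) \<le> 0 * (norm (Rr t - Sr t))\<^sup>2"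
    using inner_mult_so3[of "\<omega> t" "Rr t - Sr t"] by (simp add: matrix_bilinear_simps)
  then show "\<exists>v w. (Rr has_vector_derivative v) (at t within J) \<and>
      (Sr has_vector_derivative w) (at t within J) \<and> (Rr t - Sr t) \<bullet> (v - w) \<le> 0 * (norm (Rr t - Sr t))\<^sup>2"
    using der[OF t] by blast
qed (use assms in \<open>auto simp: state_curve_def\<close>)

lemma solution_a_unique:
  assumes \<omega>: "target_velocity \<omega>" and sol: "solution_a \<omega> J Rr R1"
    and G: "solution_a \<omega> {0..} Gr G1" and init: "Rr 0 = Gr 0" "R1 0 = G1 0" and "b \<in> J"
  shows "Rr b = Gr b \<and> R1 b = G1 b"
proof -
  note c = solution_a_D(1)[OF sol]
  then have J: "solution_domain J" "J \<subseteq> {0..}" by (auto simp: state_curve_def solution_domain_def)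
  note cG = state_curve_subset[OF solution_a_D(1)[OF G] J]
  obtain N1 where N1: "negligible N1" "\<And>t. t \<in> J - N1 \<Longrightarrow> (Rr has_vector_derivative Rr t ** \<omega> t) (at t within J)"
    "\<And>t. t \<in> J - N1 \<Longrightarrow> (R1 has_vector_derivative field_a (\<omega> t) (Rr t, R1 t)) (at t within J)"
    using solution_a_D(2)[OF sol] by blast
  obtain N2 where N2: "negligible N2" "\<And>t. t \<in> {0..} - N2 \<Longrightarrow> (Gr has_vector_derivative Gr t ** \<omega> t) (at t within {0..})"
    "\<And>t. t \<in> {0..} - N2 \<Longrightarrow> (G1 has_vector_derivative field_a (\<omega> t) (Gr t, G1 t)) (at t within {0..})"
    using solution_a_D(2)[OF G] by blast
  have N: "negligible (N1 \<union> N2)" using N1(1) N2(1) by simp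
  have sub: "t \<in> {0..} - N2" if "t \<in> J - (N1 \<union> N2)" for t using that J(2) by blast
  \<comment> \<open>The references are identified first, because the one-sided estimate compares two
    states with the same reference.\<close>
  have ref: "Rr t = Gr t" if "t \<in> J" for t
    by (rule reference_unique[OF \<omega> c cG N])
       (use N1(2) has_vector_derivative_within_subset[OF N2(2)[OF sub] J(2)] init that in auto)
  obtain L where L: "\<And>Rr R1 S1 w. \<lbrakk>Rr \<in> SO3; R1 \<in> SO3; S1 \<in> SO3; w \<in> so3\<rbrakk> \<Longrightarrow>
      (R1 - S1) \<bullet> (field_a w (Rr, R1) - field_a w (Rr, S1)) \<le> L * (norm (R1 - S1))\<^sup>2"
    using field_one_sided_Lipschitz by metis
  have "R1 b = G1 b"
  proof (rule absolutely_continuous_curves_agree[OF J(1) _ _ N, where L = L])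
    fix t assume t: "t \<in> J - (N1 \<union> N2)"
    then have "\<omega> t \<in> so3" using \<omega> J(2) by (auto simp: target_velocity_def)
    moreover have "Gr t \<in> SO3" "R1 t \<in> SO3" "G1 t \<in> SO3"
      using c cG t by (auto simp: state_curve_def state_space_def)
    ultimately have "(R1 t - G1 t) \<bullet> (field_a (\<omega> t) (Gr t, R1 t) - field_a (\<omega> t) (Gr t, G1 t)) \<le> L * (norm (R1 t - G1 t))\<^sup>2"
      by (intro L)
    moreover have "(R1 has_vector_derivative field_a (\<omega> t) (Gr t, R1 t)) (at t within J)"
      using N1(3)[of t] ref[of t] t by auto
    moreover have "(G1 has_vector_derivative field_a (\<omega> t) (Gr t, G1 t)) (at t within J)"
      by (rule has_vector_derivative_within_subset[OF N2(3)[OF sub[OF t]] J(2)])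
    ultimately show "\<exists>v w. (R1 has_vector_derivative v) (at t within J) \<and>
        (G1 has_vector_derivative w) (at t within J) \<and> (R1 t - G1 t) \<bullet> (v - w) \<le> L * (norm (R1 t - G1 t))\<^sup>2"
      by blast
  qed (use c cG init \<open>b \<in> J\<close> in \<open>auto simp: state_curve_def\<close>)
  with ref[OF \<open>b \<in> J\<close>] show ?thesis by blast
qed

text \<open>The comparison curve is given by its relative rotation \<open>Q t\<close>, with the
  value of \<open>field_f\<close> as derivative, because the Filippov estimate compares an arbitrary
  velocity with exactly that value, \<open>Q\<close> being frozen at the time considered.\<close>

lemma solution_f_unique:
  assumes \<omega>: "target_velocity \<omega>" and sol: "solution_f \<omega> J Rr R1"
    and G: "state_curve {0..} Gr (\<lambda>t. Q t ** Gr t)" and N2: "negligible N2"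
    and Grder: "\<And>t. t \<in> {0..} - N2 \<Longrightarrow> (Gr has_vector_derivative Gr t ** \<omega> t) (at t within {0..})"
    and G1der: "\<And>t. t \<in> {0..} - N2 \<Longrightarrow>
      ((\<lambda>t. Q t ** Gr t) has_vector_derivative field_f (\<omega> t) (Gr t, Q t ** Gr t)) (at t within {0..})"
    and Q: "\<And>t. Q t \<in> SO3"
    and init: "Rr 0 = Gr 0" "R1 0 = Q 0 ** Gr 0" and "b \<in> J"
  shows "Rr b = Gr b \<and> R1 b = Q b ** Gr b"
proof -
  note c = solution_f_D(1)[OF sol]
  then have J: "solution_domain J" "J \<subseteq> {0..}" by (auto simp: state_curve_def solution_domain_def)
  note cG = state_curve_subset[OF G J]
  obtain N1 where N1: "negligible N1" "\<And>t. t \<in> J - N1 \<Longrightarrow> (Rr has_vector_derivative Rr t ** \<omega> t) (at t within J)"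
    "\<And>t. t \<in> J - N1 \<Longrightarrow> \<exists>V \<in> filippov (\<lambda>(Pr, P1) t. P1 ** omega_f Pr P1 (\<omega> t)) (Rr t, R1 t) t.
           (R1 has_vector_derivative V) (at t within J)"
    using solution_f_D(2)[OF sol] by blast
  have N: "negligible (N1 \<union> N2)" using N1(1) N2 by simp
  have sub: "t \<in> {0..} - N2" if "t \<in> J - (N1 \<union> N2)" for t using that J(2) by blast
  have ref: "Rr t = Gr t" if "t \<in> J" for t
    by (rule reference_unique[OF \<omega> c cG N])
       (use N1(2) has_vector_derivative_within_subset[OF Grder[OF sub] J(2)] init that in auto)
  obtain L where L: "\<And>Rr R1 Q w t V. \<lbrakk>Rr \<in> SO3; R1 \<in> SO3; Q \<in> SO3; w t \<in> so3;
      V \<in> filippov (\<lambda>(Pr, P1) t. P1 ** omega_f Pr P1 (w t)) (Rr, R1) t\<rbrakk> \<Longrightarrow>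
      (R1 - Q ** Rr) \<bullet> (V - field_f (w t) (Rr, Q ** Rr)) \<le> L * (norm (R1 - Q ** Rr))\<^sup>2"
    using filippov_one_sided_Lipschitz by blast
  have "R1 b = Q b ** Gr b"
  proof (rule absolutely_continuous_curves_agree[OF J(1) _ _ N, where L = L])
    fix t assume t: "t \<in> J - (N1 \<union> N2)"
    then have "\<omega> t \<in> so3" using \<omega> J(2) by (auto simp: target_velocity_def)
    moreover have "Gr t \<in> SO3" "R1 t \<in> SO3"
      using c cG t by (auto simp: state_curve_def state_space_def)
    moreover obtain V where V: "V \<in> filippov (\<lambda>(Pr, P1) t. P1 ** omega_f Pr P1 (\<omega> t)) (Gr t, R1 t) t"
      "(R1 has_vector_derivative V) (at t within J)"
      using N1(3)[of t] ref[of t] t by auto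
    ultimately have "(R1 t - Q t ** Gr t) \<bullet> (V - field_f (\<omega> t) (Gr t, Q t ** Gr t)) \<le> L * (norm (R1 t - Q t ** Gr t))\<^sup>2"
      by (intro L Q)
    moreover have "((\<lambda>t. Q t ** Gr t) has_vector_derivative field_f (\<omega> t) (Gr t, Q t ** Gr t)) (at t within J)"
      by (rule has_vector_derivative_within_subset[OF G1der[OF sub[OF t]] J(2)])
    ultimately show "\<exists>v w. (R1 has_vector_derivative v) (at t within J) \<and>
        ((\<lambda>t. Q t ** Gr t) has_vector_derivative w) (at t within J) \<and>
        (R1 t - Q t ** Gr t) \<bullet> (v - w) \<le> L * (norm (R1 t - Q t ** Gr t))\<^sup>2"
      using V(2) by blast
  qed (use c cG init \<open>b \<in> J\<close> in \<open>auto simp: state_curve_def\<close>)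
  with ref[OF \<open>b \<in> J\<close>] show ?thesis by blast
qed

text \<open>Along the finite-time law \<open>sinh z = s * norm p\<close> turns the radial equation into
  \<open>z' = - 1 / sqrt 2\<close>; for \<open>p = 0\<close> the junk value \<open>x / 0 = 0\<close> is harmless, as only \<open>s *\<^sub>R p\<close> matters.\<close>

definition radius_f :: "real^3 \<Rightarrow> real \<Rightarrow> real" where
  "radius_f p t = sinh (max 0 (arsinh (norm p) - t / sqrt 2)) / norm p"

lemma radius_f_lipschitz: "\<exists>L. L-lipschitz_on {0..T} (radius_f p)"
proof -
  let ?z = "\<lambda>t. max 0 (arsinh (norm p) - t / sqrt 2)"
  have z: "1-lipschitz_on {0..T} ?z"
  proof (rule lipschitz_onI)
    fix x y :: real
    have "\<bar>x / sqrt 2 - y / sqrt 2\<bar> = \<bar>x - y\<bar> / sqrt 2" by (simp add: abs_divide flip: diff_divide_distrib)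
    also have "\<dots> \<le> \<bar>x - y\<bar> / 1" by (intro divide_left_mono) auto
    finally show "dist (?z x) (?z y) \<le> 1 * dist x y" by (auto simp: dist_real_def max_def)
  qed simp
  have sub: "?z ` {0..T} \<subseteq> {0..arsinh (norm p)}" using sinh_real_nonneg_iff[of "arsinh (norm p)"] by auto
  have "((\<lambda>z. sinh z / norm p) has_real_derivative cosh z / norm p) (at z within {0..arsinh (norm p)})" for z
    by (intro DERIV_cdivide) (auto intro!: derivative_eq_intros)
  moreover have "continuous_on {0..arsinh (norm p)} (\<lambda>z. cosh z / norm p)"
    by (cases "p = 0") (auto intro!: continuous_intros)
  ultimately have "\<exists>L. L-lipschitz_on {0..arsinh (norm p)} (\<lambda>z. sinh z / norm p)"
    by (intro C1_imp_lipschitz_on) (simp_all add: has_real_derivative_iff_has_vector_derivative)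
  then obtain L where "L-lipschitz_on {0..arsinh (norm p)} (\<lambda>z. sinh z / norm p)" by blast
  from lipschitz_on_compose2[OF z lipschitz_on_subset[OF this sub]]
  show ?thesis unfolding radius_f_def[abs_def] by blast
qed

text \<open>The excluded time is the kink of the maximum, where the curve reaches the diagonal;
  afterwards both sides are 0.\<close>

lemma radius_f_derivative:
  assumes "t \<noteq> sqrt 2 * arsinh (norm p)" "0 \<le> t"
  shows "(radius_f p has_real_derivative
      - 2 * radius_f p t * (1 / norm (cayley (radius_f p t *\<^sub>R p) - mat 1))) (at t within {0..})"
proof (cases "t < sqrt 2 * arsinh (norm p)")
  case True
  define z where "z = (\<lambda>t. arsinh (norm p) - t / sqrt 2)"
  have zpos: "0 < z r" if "r < sqrt 2 * arsinh (norm p)" for r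
    using that by (simp add: z_def field_simps)
  have "p \<noteq> 0" using True assms(2) by auto
  define m where "m = norm p"
  have "m > 0" using \<open>p \<noteq> 0\<close> by (simp add: m_def)
  have eq: "radius_f p r = sinh (z r) / m" if "r < sqrt 2 * arsinh (norm p)" for r
    using zpos[OF that] by (simp add: radius_f_def z_def m_def)
  have "((\<lambda>r. sinh (z r) / m) has_real_derivative - (cosh (z t) / (sqrt 2 * m))) (at t)"
    unfolding z_def using \<open>m > 0\<close> by (auto intro!: derivative_eq_intros simp: field_simps)
  then have "(radius_f p has_real_derivative - (cosh (z t) / (sqrt 2 * m))) (at t)"
    by (rule has_field_derivative_transform_within_open[where S = "{..<sqrt 2 * arsinh (norm p)}"])
       (use True eq in auto)
  then have d: "(radius_f p has_real_derivative - (cosh (z t) / (sqrt 2 * m))) (at t within {0..})"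
    by (rule has_field_derivative_at_within)
  have "radius_f p t *\<^sub>R p \<bullet> radius_f p t *\<^sub>R p = (sinh (z t))\<^sup>2"
    using \<open>m > 0\<close> by (simp add: eq[OF True] power2_eq_square m_def dot_square_norm)
  then have "norm (cayley (radius_f p t *\<^sub>R p) - mat 1) = sqrt (8 * (sinh (z t))\<^sup>2 / (1 + (sinh (z t))\<^sup>2))"
    using norm_cayley_minus_one[of "radius_f p t *\<^sub>R p"] by simp
  \<comment> \<open>With sinh z = s m the gain is cosh z / (2 sqrt 2 sinh z). Its sinh cancels the
    one in -2 s and leaves - cosh z / (sqrt 2 m), the derivative found above.\<close>
  also have "\<dots> = 2 * sqrt 2 * sinh (z t) / cosh (z t)"
  proof -
    have "8 * (sinh (z t))\<^sup>2 / (1 + (sinh (z t))\<^sup>2) = (2 * sinh (z t) / cosh (z t))\<^sup>2 * 2"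
      by (simp add: cosh_square_eq power_divide power_mult_distrib add.commute)
    then show ?thesis
      using zpos[OF True] by (simp add: real_sqrt_mult)
  qed
  finally have n: "norm (cayley (radius_f p t *\<^sub>R p) - mat 1) = 2 * sqrt 2 * sinh (z t) / cosh (z t)" .
  have "sinh (z t) > 0" "cosh (z t) > 0" using zpos[OF True] by (simp_all add: cosh_real_pos)
  then have "- 2 * radius_f p t * (1 / norm (cayley (radius_f p t *\<^sub>R p) - mat 1)) = - (cosh (z t) / (sqrt 2 * m))"
    unfolding n unfolding eq[OF True] using \<open>m > 0\<close> by (simp add: field_simps)
  with d show ?thesis by simp
next
  case False
  then have t: "t \<in> {sqrt 2 * arsinh (norm p)<..}" using assms(1) by auto
  have eq: "radius_f p r = 0" if "r \<in> {sqrt 2 * arsinh (norm p)<..}" for r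
    using that by (simp add: radius_f_def field_simps max_def)
  have "((\<lambda>_. 0) has_real_derivative 0) (at t)" by simp
  then have "(radius_f p has_real_derivative 0) (at t)"
    by (rule has_field_derivative_transform_within_open[where S = "{sqrt 2 * arsinh (norm p)<..}"])
       (use t eq in auto)
  then have "(radius_f p has_real_derivative 0) (at t within {0..})"
    by (rule has_field_derivative_at_within)
  then show ?thesis using eq[OF t] by simp
qed

section \<open>Explicit solutions\<close>

lemma solution_a_exists:
  assumes R: "\<And>t. 0 \<le> t \<Longrightarrow> Rr t \<in> SO3" "\<And>T. \<exists>L. L-lipschitz_on {0..T} Rr"
    and N: "negligible N"
    and der: "\<And>t. t \<in> {0..} - N \<Longrightarrow> (Rr has_vector_derivative Rr t ** \<omega> t) (at t within {0..})"
  shows "solution_a \<omega> {0..} Rr (\<lambda>t. cayley (exp (- 2 * t) *\<^sub>R p) ** Rr t)"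
  unfolding solution_a_def
proof
  have lip: "\<exists>L. L-lipschitz_on {0..T} (\<lambda>t :: real. exp (- 2 * t))" for T
    by (rule C1_imp_lipschitz_on[where f' = "\<lambda>t. exp (- 2 * t) * - 2"])
       (auto intro!: continuous_intros derivative_eq_intros
         simp: has_real_derivative_iff_has_vector_derivative[symmetric])
  show "state_curve {0..} Rr (\<lambda>t. cayley (exp (- 2 * t) *\<^sub>R p) ** Rr t)"
    by (rule relative_curve_state_curve[OF R lip])
  show "AE t in lebesgue_on {0..}. (Rr has_vector_derivative Rr t ** \<omega> t) (at t within {0..}) \<and>
      ((\<lambda>t. cayley (exp (- 2 * t) *\<^sub>R p) ** Rr t) has_vector_derivative
        cayley (exp (- 2 * t) *\<^sub>R p) ** Rr t ** omega_a (Rr t) (cayley (exp (- 2 * t) *\<^sub>R p) ** Rr t) (\<omega> t))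
      (at t within {0..})"
  proof (rule AE_Ici_if_negligible[OF N], rule conjI)
    fix t :: real assume t: "t \<in> {0..} - N"
    show "(Rr has_vector_derivative Rr t ** \<omega> t) (at t within {0..})" by (rule der[OF t])
    \<comment> \<open>The factor 1 exhibits the gain \<open>g\<close> of the first law.\<close>
    have "((\<lambda>t. exp (- 2 * t)) has_real_derivative - 2 * exp (- 2 * t) * 1) (at t within {0..})"
      by (auto intro!: derivative_eq_intros)
    from relative_curve_derivative[OF der[OF t] this, of p]
    show "((\<lambda>t. cayley (exp (- 2 * t) *\<^sub>R p) ** Rr t) has_vector_derivative
        cayley (exp (- 2 * t) *\<^sub>R p) ** Rr t ** omega_a (Rr t) (cayley (exp (- 2 * t) *\<^sub>R p) ** Rr t) (\<omega> t))
      (at t within {0..})"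
      using field_a_relative[OF R(1) cayley_SO3, of t "\<omega> t" "exp (- 2 * t) *\<^sub>R p"] t
      by (simp add: field_a_def)
  qed
qed

lemma radius_f_curve_derivative:
  assumes "Rr t \<in> SO3" "(Rr has_vector_derivative Rr t ** w) (at t within {0..})"
    and t: "t \<noteq> sqrt 2 * arsinh (norm p)" "0 \<le> t"
  shows "((\<lambda>t. cayley (radius_f p t *\<^sub>R p) ** Rr t) has_vector_derivative
      field_f w (Rr t, cayley (radius_f p t *\<^sub>R p) ** Rr t)) (at t within {0..})"
  using relative_curve_derivative[OF assms(2) radius_f_derivative[OF t]]
  by (simp add: field_f_relative[OF assms(1) cayley_SO3])

lemma solution_f_exists:
  assumes R: "\<And>t. 0 \<le> t \<Longrightarrow> Rr t \<in> SO3" "\<And>T. \<exists>L. L-lipschitz_on {0..T} Rr"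
    and N: "negligible N"
    and der: "\<And>t. t \<in> {0..} - N \<Longrightarrow> (Rr has_vector_derivative Rr t ** \<omega> t) (at t within {0..})"
  shows "solution_f \<omega> {0..} Rr (\<lambda>t. cayley (radius_f p t *\<^sub>R p) ** Rr t)"
  unfolding solution_f_def
proof
  show "state_curve {0..} Rr (\<lambda>t. cayley (radius_f p t *\<^sub>R p) ** Rr t)"
    by (rule relative_curve_state_curve[OF R radius_f_lipschitz])
  have N': "negligible (N \<union> {sqrt 2 * arsinh (norm p)})" using N by simp
  show "AE t in lebesgue_on {0..}. (Rr has_vector_derivative Rr t ** \<omega> t) (at t within {0..}) \<and>
      (\<exists>V\<in>filippov (\<lambda>(Pr, P1) t. P1 ** omega_f Pr P1 (\<omega> t)) (Rr t, cayley (radius_f p t *\<^sub>R p) ** Rr t) t.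
        ((\<lambda>t. cayley (radius_f p t *\<^sub>R p) ** Rr t) has_vector_derivative V) (at t within {0..}))"
  proof (rule AE_Ici_if_negligible[OF N'], rule conjI)
    fix t :: real assume t: "t \<in> {0..} - (N \<union> {sqrt 2 * arsinh (norm p)})"
    define R1 where "R1 = cayley (radius_f p t *\<^sub>R p) ** Rr t"
    have Rt: "Rr t \<in> SO3" using t R(1) by simp
    show d: "(Rr has_vector_derivative Rr t ** \<omega> t) (at t within {0..})" using der t by simp
    have "((\<lambda>t. cayley (radius_f p t *\<^sub>R p) ** Rr t) has_vector_derivative field_f (\<omega> t) (Rr t, R1)) (at t within {0..})"
      unfolding R1_def by (rule radius_f_curve_derivative[OF Rt d]) (use t in auto)
    moreover have "field_f (\<omega> t) (Rr t, R1) \<in> filippov (\<lambda>(Pr, P1) t. P1 ** omega_f Pr P1 (\<omega> t)) (Rr t, R1) t"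
    \<comment> \<open>After its arrival the curve stays on the diagonal. There the default value of
      \<open>omega_f\<close> yields the velocity of the reference, which still has to be recognised
      as a Filippov velocity.\<close>
    proof (cases "R1 = Rr t")
      case True
      then have "field_f (\<omega> t) (Rr t, R1) = Rr t ** \<omega> t" by (simp add: field_f_def omega_f_def)
      then show ?thesis using diagonal_velocity_in_filippov[OF Rt] True by simp
    next
      case False
      then show ?thesis
        using Rt by (intro field_f_in_filippov) (auto simp: state_space_def R1_def SO3_mult cayley_SO3)
    qed
    ultimately show "\<exists>V\<in>filippov (\<lambda>(Pr, P1) t. P1 ** omega_f Pr P1 (\<omega> t)) (Rr t, cayley (radius_f p t *\<^sub>R p) ** Rr t) t.
        ((\<lambda>t. cayley (radius_f p t *\<^sub>R p) ** Rr t) has_vector_derivative V) (at t within {0..})"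
      unfolding R1_def by blast
  qed
qed

section \<open>Nonsingularity, maximal solutions and tracking\<close>

lemma trace_relative: "trace (transpose Rr ** R1) = trace (R1 ** transpose Rr)" for Rr R1 :: mat3
  by (rule trace_mul_sym)

lemma nonsingular_imp_cayley:
  assumes "Rr \<in> SO3" "R1 \<in> SO3" and ne: "rotation_distance Rr R1 \<noteq> pi"
  obtains p where "R1 = cayley p ** Rr"
proof -
  define Q where "Q = R1 ** transpose Rr"
  have Q: "Q \<in> SO3" unfolding Q_def by (intro SO3_mult SO3_transpose assms)
  \<comment> \<open>Trace -1 would make the argument of arccos equal to -1, that is, the distance
    equal to pi.\<close>
  have "trace Q \<noteq> -1"
    using ne by (auto simp: rotation_distance_def trace_relative Q_def[symmetric])
  then have "R1 = cayley (cayley_inv Q) ** Rr"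
    by (simp add: cayley_cayley_inv[OF Q]) (simp add: Q_def SO3_transpose_mult[OF assms(1)] flip: matrix_mul_assoc)
  then show thesis by (rule that)
qed

lemma rotation_distance_cayley:
  assumes "Rr \<in> SO3"
  shows "rotation_distance Rr (cayley p ** Rr) \<noteq> pi"
proof
  define c where "c = (trace (cayley p) - 1) / 2"
  have "trace (transpose Rr ** (cayley p ** Rr)) = trace (cayley p ** (Rr ** transpose Rr))"
    unfolding trace_relative[of Rr "cayley p ** Rr"] by (simp add: matrix_mul_assoc)
  also have "\<dots> = trace (cayley p)" by (simp add: SO3_mult_transpose[OF assms])
  finally have "rotation_distance Rr (cayley p ** Rr) = arccos c"
    by (simp add: rotation_distance_def c_def)
  moreover assume "rotation_distance Rr (cayley p ** Rr) = pi"
  ultimately have "arccos c = pi" by simp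
  have "c = (1 + trace (cayley p)) / 2 - 1" by (simp add: c_def field_simps)
  moreover have "4 / x / 2 = 2 / x" for x :: real by simp
  ultimately have c: "c = 2 / (1 + p \<bullet> p) - 1" by (simp only: trace_cayley)
  \<comment> \<open>The bounds place \<open>c\<close> in the interval where cos inverts arccos, and
    the strict one excludes c = -1 = cos pi.\<close>
  have "0 < 2 / (1 + p \<bullet> p)" "2 / (1 + p \<bullet> p) \<le> 2"
    using one_plus_inner_pos[of p] by (simp_all add: field_simps)
  then have "-1 < c" "c \<le> 1" unfolding c by linarith+
  then show False using cos_arccos[of c] \<open>arccos c = pi\<close> by simp
qed

lemma norm_relative_error:
  assumes "Rr \<in> SO3"
  shows "norm (cayley p ** Rr - Rr) = sqrt (8 * (p \<bullet> p) / (1 + p \<bullet> p))"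
proof -
  have "cayley p ** Rr - Rr = (cayley p - mat 1) ** Rr" by (simp add: matrix_bilinear_simps)
  then show ?thesis by (simp add: norm_SO3_mult[OF assms] norm_cayley_minus_one)
qed

lemma maximal_solution_domain:
  assumes "maximal_solution sol J Rr R1" "J \<subseteq> K" "sol K Sr S1"
    and "\<And>t. t \<in> J \<Longrightarrow> Rr t = Sr t \<and> R1 t = S1 t"
  shows "J = K"
  using assms unfolding maximal_solution_def by (metis psubsetI)

lemma maximal_solution_a:
  assumes \<omega>: "target_velocity \<omega>" and max: "maximal_solution (solution_a \<omega>) J Rr R1"
    and ne: "rotation_distance (Rr 0) (R1 0) \<noteq> pi"
  obtains p where "J = {0..}" "\<And>t. 0 \<le> t \<Longrightarrow> Rr t \<in> SO3"
    "\<And>t. 0 \<le> t \<Longrightarrow> R1 t = cayley (exp (- 2 * t) *\<^sub>R p) ** Rr t"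
proof -
  have sol: "solution_a \<omega> J Rr R1" using max by (simp add: maximal_solution_def)
  then have c: "state_curve J Rr R1" by (rule solution_a_D)
  then have J: "0 \<in> J" "J \<subseteq> {0..}" and init: "Rr 0 \<in> SO3" "R1 0 \<in> SO3"
    by (auto simp: state_curve_def solution_domain_def state_space_def)
  obtain p where p: "R1 0 = cayley p ** Rr 0" by (rule nonsingular_imp_cayley[OF init ne])
  obtain Gr N where G: "Gr 0 = Rr 0" "\<And>t. 0 \<le> t \<Longrightarrow> Gr t \<in> SO3" "\<And>T. \<exists>L. L-lipschitz_on {0..T} Gr" "negligible N"
    "\<And>t. t \<in> {0..} - N \<Longrightarrow> (Gr has_vector_derivative Gr t ** \<omega> t) (at t within {0..})"
    using reference_exists[OF \<omega> init(1)] by blast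
  define G1 where "G1 = (\<lambda>t. cayley (exp (- 2 * t) *\<^sub>R p) ** Gr t)"
  have solG: "solution_a \<omega> {0..} Gr G1" unfolding G1_def by (rule solution_a_exists[OF G(2-5)])
  have eq: "Rr t = Gr t \<and> R1 t = G1 t" if "t \<in> J" for t
    by (rule solution_a_unique[OF \<omega> sol solG _ _ that]) (simp_all add: G(1) p G1_def)
  have "J = {0..}" by (rule maximal_solution_domain[OF max J(2) solG eq])
  then show thesis using that[of p] eq G(2) by (auto simp: G1_def)
qed

lemma maximal_solution_f:
  assumes \<omega>: "target_velocity \<omega>" and max: "maximal_solution (solution_f \<omega>) J Rr R1"
    and ne: "rotation_distance (Rr 0) (R1 0) \<noteq> pi"
  obtains p where "J = {0..}" "\<And>t. 0 \<le> t \<Longrightarrow> Rr t \<in> SO3"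
    "\<And>t. 0 \<le> t \<Longrightarrow> R1 t = cayley (radius_f p t *\<^sub>R p) ** Rr t"
proof -
  have sol: "solution_f \<omega> J Rr R1" using max by (simp add: maximal_solution_def)
  then have c: "state_curve J Rr R1" by (rule solution_f_D)
  then have J: "0 \<in> J" "J \<subseteq> {0..}" and init: "Rr 0 \<in> SO3" "R1 0 \<in> SO3"
    by (auto simp: state_curve_def solution_domain_def state_space_def)
  obtain p where p: "R1 0 = cayley p ** Rr 0" by (rule nonsingular_imp_cayley[OF init ne])
  obtain Gr N where G: "Gr 0 = Rr 0" "\<And>t. 0 \<le> t \<Longrightarrow> Gr t \<in> SO3" "\<And>T. \<exists>L. L-lipschitz_on {0..T} Gr" "negligible N"
    "\<And>t. t \<in> {0..} - N \<Longrightarrow> (Gr has_vector_derivative Gr t ** \<omega> t) (at t within {0..})"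
    using reference_exists[OF \<omega> init(1)] by blast
  define Q where "Q = (\<lambda>t. cayley (radius_f p t *\<^sub>R p))"
  have solG: "solution_f \<omega> {0..} Gr (\<lambda>t. Q t ** Gr t)"
    unfolding Q_def by (rule solution_f_exists[OF G(2-5)])
  \<comment> \<open>If p = 0 the radius starts at 0 / 0 = 0 instead of 1, yet its product with
    \<open>p\<close> is still \<open>p\<close>.\<close>
  have Q0: "radius_f p 0 *\<^sub>R p = p"
    using sinh_real_nonneg_iff[of "arsinh (norm p)"] by (cases "p = 0") (simp_all add: radius_f_def)
  have N': "negligible (N \<union> {sqrt 2 * arsinh (norm p)})" using G(4) by simp
  have eq: "Rr t = Gr t \<and> R1 t = Q t ** Gr t" if "t \<in> J" for t
  proof (rule solution_f_unique[OF \<omega> sol solution_f_D(1)[OF solG] N' _ _ _ _ _ that])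
    fix t assume t: "t \<in> {0..} - (N \<union> {sqrt 2 * arsinh (norm p)})"
    show d: "(Gr has_vector_derivative Gr t ** \<omega> t) (at t within {0..})" using G(5) t by simp
    show "((\<lambda>t. Q t ** Gr t) has_vector_derivative field_f (\<omega> t) (Gr t, Q t ** Gr t)) (at t within {0..})"
      unfolding Q_def by (rule radius_f_curve_derivative[OF G(2) d]) (use t in auto)
  qed (simp_all add: G(1) p Q0 Q_def cayley_SO3)
  have "J = {0..}" by (rule maximal_solution_domain[OF max J(2) solG eq])
  then show thesis using that[of p] eq G(2) by (auto simp: Q_def)
qed

theorem corollary3:
  fixes \<omega>r :: "real \<Rightarrow> real^3^3"
  assumes "target_velocity \<omega>r"
  shows
    "(\<forall>sol \<in> {solution_a \<omega>r, solution_f \<omega>r}. \<forall>J Rr R1.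
        maximal_solution sol J Rr R1 \<and> rotation_distance (Rr 0) (R1 0) \<noteq> pi \<longrightarrow>
        J = {0..} \<and> (\<forall>t\<ge>0. rotation_distance (Rr t) (R1 t) \<noteq> pi)) \<and>
     (\<forall>J Rr R1.
        maximal_solution (solution_a \<omega>r) J Rr R1 \<and> rotation_distance (Rr 0) (R1 0) \<noteq> pi \<longrightarrow>
        tracks_exponentially R1 Rr) \<and>
     (\<forall>J Rr R1.
        maximal_solution (solution_f \<omega>r) J Rr R1 \<and> rotation_distance (Rr 0) (R1 0) \<noteq> pi \<longrightarrow>
        tracks_in_finite_time R1 Rr)"
proof (intro conjI allI ballI impI; elim conjE)
  fix sol J Rr R1
  assume sol: "sol \<in> {solution_a \<omega>r, solution_f \<omega>r}" and max: "maximal_solution sol J Rr R1"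
    and ne: "rotation_distance (Rr 0) (R1 0) \<noteq> pi"
  \<comment> \<open>That the relative rotation is a Cayley transform at every time is the form of
    nonsingularity common to both laws.\<close>
  have "J = {0..} \<and> (\<forall>t\<ge>0. \<exists>q. Rr t \<in> SO3 \<and> R1 t = cayley q ** Rr t)"
  proof (cases "sol = solution_a \<omega>r")
    case True
    show ?thesis by (rule maximal_solution_a[OF assms max[unfolded True] ne]) auto
  next
    case False
    then have eq: "sol = solution_f \<omega>r" using sol by blast
    show ?thesis by (rule maximal_solution_f[OF assms max[unfolded eq] ne]) auto
  qed
  then show "J = {0..}" "\<And>t. 0 \<le> t \<Longrightarrow> rotation_distance (Rr t) (R1 t) \<noteq> pi"
    using rotation_distance_cayley by (blast, metis)
next
  fix J Rr R1
  assume max: "maximal_solution (solution_a \<omega>r) J Rr R1" and ne: "rotation_distance (Rr 0) (R1 0) \<noteq> pi"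
  obtain p where "J = {0..}" and R: "\<And>t. 0 \<le> t \<Longrightarrow> Rr t \<in> SO3"
    "\<And>t. 0 \<le> t \<Longrightarrow> R1 t = cayley (exp (- 2 * t) *\<^sub>R p) ** Rr t"
    using maximal_solution_a[OF assms max ne] by blast
  \<comment> \<open>The summand 1 keeps the constant positive when the initial error is 0.\<close>
  have "norm (R1 t - Rr t) \<le> (sqrt 8 * norm p + 1) * exp (- 2 * t)" if "0 \<le> t" for t
  proof -
    define q where "q = exp (- 2 * t) *\<^sub>R p"
    have "8 * (q \<bullet> q) / (1 + q \<bullet> q) \<le> 8 * (q \<bullet> q) / 1"
      using one_plus_inner_pos[of q] by (intro divide_left_mono) auto
    then have "norm (R1 t - Rr t) \<le> sqrt (8 * (q \<bullet> q))"
      using norm_relative_error[OF R(1)[OF that], of q] R(2)[OF that] by (simp add: q_def)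
    also have "\<dots> = sqrt 8 * norm p * exp (- 2 * t)"
      by (simp add: real_sqrt_mult norm_eq_sqrt_inner[symmetric] q_def)
    also have "\<dots> \<le> (sqrt 8 * norm p + 1) * exp (- 2 * t)" by (intro mult_right_mono) auto
    finally show ?thesis .
  qed
  moreover have "0 < sqrt 8 * norm p + 1" by (simp add: add_nonneg_pos)
  ultimately show "tracks_exponentially R1 Rr"
    unfolding tracks_exponentially_def by (metis zero_less_numeral)
next
  fix J Rr R1
  assume max: "maximal_solution (solution_f \<omega>r) J Rr R1" and ne: "rotation_distance (Rr 0) (R1 0) \<noteq> pi"
  obtain p where "J = {0..}" and R: "\<And>t. 0 \<le> t \<Longrightarrow> Rr t \<in> SO3"
    "\<And>t. 0 \<le> t \<Longrightarrow> R1 t = cayley (radius_f p t *\<^sub>R p) ** Rr t"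
    using maximal_solution_f[OF assms max ne] by blast
  define T where "T = sqrt 2 * arsinh (norm p)"
  have "0 \<le> T" using sinh_real_nonneg_iff[of "arsinh (norm p)"] by (simp add: T_def)
  have zero: "R1 t - Rr t = 0" if "T < t" for t
  proof -
    have "radius_f p t = 0" using that by (simp add: radius_f_def T_def field_simps max_def)
    then show ?thesis using R(2)[of t] that \<open>0 \<le> T\<close> by simp
  qed
  \<comment> \<open>The error vanishes on a whole neighbourhood of T + 1, and T + 1 is positive even
    when p = 0 and hence T = 0.\<close>
  have "\<forall>\<^sub>F t in at (T + 1). R1 t - Rr t = 0"
    by (rule eventually_at_in_open'[THEN eventually_mono, of "{T<..}"]) (use zero in auto)
  then have "((\<lambda>t. R1 t - Rr t) \<longlongrightarrow> 0) (at (T + 1))" by (rule tendsto_eventually)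
  then show "tracks_in_finite_time R1 Rr"
    unfolding tracks_in_finite_time_def using \<open>0 \<le> T\<close> by (intro exI[of _ "T + 1"]) auto
qed

end
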